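(* Suppose that $\mathrm{rank}(\mathbf{H}_{qq})=n_{R_q}$ for all $q\in\Omega$. Then for any $\mathbf{w}=[w_1,\ldots,w_Q]^T>\mathbf{0}$ the multiuser waterfilling mapping $\mathbf{WF}:\mathscr{Q}\to\mathscr{Q}$ is Lipschitz continuous on $\mathscr{Q}$: $$\big\|\mathbf{WF}(\mathbf{Q}^{(1)})-\mathbf{WF}(\mathbf{Q}^{(2)})\big\|_{F,\mathrm{block}}^{\mathbf{w}}\le\|\mathbf{S}\|_{\infty,\mathrm{mat}}^{\mathbf{w}}\,\big\|\mathbf{Q}^{(1)}-\mathbf{Q}^{(2)}\big\|_{F,\mathrm{block}}^{\mathbf{w}}\qquad\forall\,\mathbf{Q}^{(1)},\mathbf{Q}^{(2)}\in\mathscr{Q}.$$ Furthermore, if $\|\mathbf{S}\|_{\infty,\mathrm{mat}}^{\mathbf{w}}<1$ for some $\mathbf{w}>\mathbf{0}$, then $\mathbf{WF}$ is a block-contraction with modulus $\beta=\|\mathbf{S}\|_{\infty,\mathrm{mat}}^{\mathbf{w}}$ (that is, a contraction with modulus $\beta$ with respect to $\|\cdot\|_{F,\mathrm{block}}^{\mathbf{w}}$).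
   Context: Setting. $\Omega=\{1,\ldots,Q\}$. For $r,q\in\Omega$, $\mathbf{H}_{rq}\in\mathbb{C}^{n_{R_q}\times n_{T_r}}$, $\mathbf{R}_{n_q}\in\mathbb{C}^{n_{R_q}\times n_{R_q}}$ is Hermitian positive definite, and $P_q>0$. The strategy sets are $\mathscr{Q}_q=\{\mathbf{Q}\in\mathbb{C}^{n_{T_q}\times n_{T_q}}:\mathbf{Q}\succeq\mathbf{0},\ \mathrm{Tr}(\mathbf{Q})=P_q\}$, $\mathscr{Q}=\mathscr{Q}_1\times\cdots\times\mathscr{Q}_Q$, $\mathscr{Q}_{-q}=\prod_{r\ne q}\mathscr{Q}_r$, and for $\mathbf{Q}_{-q}=(\mathbf{Q}_r)_{r\neq q}\in\mathscr{Q}_{-q}$, $\mathbf{R}_{-q}(\mathbf{Q}_{-q})=\mathbf{R}_{n_q}+\sum_{r\neq q}\mathbf{H}_{rq}\mathbf{Q}_r\mathbf{H}_{rq}^H$. Waterfilling mapping. Write the reduced eigendecomposition $\mathbf{H}_{qq}^H\mathbf{R}_{-q}^{-1}(\mathbf{Q}_{-q})\mathbf{H}_{qq}=\mathbf{U}_q\mathbf{D}_q\mathbf{U}_q^H$, with $\mathbf{U}_q\in\mathbb{C}^{n_{T_q}\times r_q}$ having orthonormal columns, $\mathbf{D}_q$ an $r_q\times r_q$ diagonal matrix with positive diagonal entries, $r_q=\mathrm{rank}(\mathbf{H}_{qq})$. Then $\mathbf{WF}_q(\mathbf{Q}_{-q})=\mathbf{U}_q(\mu_q\mathbf{I}-\mathbf{D}_q^{-1})^+\mathbf{U}_q^H$,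 where $(\cdot)^+=\max(0,\cdot)$ acts on the diagonal entries and $\mu_q$ is chosen so that $\mathrm{Tr}\{(\mu_q\mathbf{I}-\mathbf{D}_q^{-1})^+\}=P_q$; and $\mathbf{WF}(\mathbf{Q})=(\mathbf{WF}_q(\mathbf{Q}_{-q}))_{q\in\Omega}$. Norms. For a tuple $\mathbf{X}=(\mathbf{X}_q)_{q\in\Omega}$, $\|\mathbf{X}\|_{F,\mathrm{block}}^{\mathbf{w}}=\max_{q}\|\mathbf{X}_q\|_F/w_q$ with $\|\cdot\|_F$ the Frobenius norm. For $\mathbf{A}\in\mathbb{R}^{Q\times Q}$, $\|\mathbf{A}\|_{\infty,\mathrm{mat}}^{\mathbf{w}}=\max_q\frac{1}{w_q}\sum_{r=1}^Q|[\mathbf{A}]_{qr}|w_r$. Vector inequalities are componentwise. Matrix $\mathbf{S}\in\mathbb{R}_+^{Q\times Q}$: $[\mathbf{S}]_{qr}=\rho\big(\mathbf{H}_{rq}^H\mathbf{H}_{qq}^{\sharp H}\mathbf{H}_{qq}^{\sharp}\mathbf{H}_{rq}\big)$ if $r\neq q$ and $[\mathbf{S}]_{qq}=0$, where $\rho$ is the spectral radius, $(\cdot)^\sharp$ the Moore-Penrose pseudoinverse, and $\mathbf{A}^{\sharp H}=(\mathbf{A}^\sharp)^H$. *)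

theory Defs
  imports
    "Jordan_Normal_Form.Schur_Decomposition"
    "Jordan_Normal_Form.Gauss_Jordan_Elimination"
    "Jordan_Normal_Form.DL_Rank"
    "Jordan_Normal_Form.Spectral_Radius"
    "HOL-Library.FuncSet"
begin

definition mat_trace :: "complex mat \<Rightarrow> complex" where
  "mat_trace A = (\<Sum>i<dim_row A. A $$ (i, i))"

definition frobenius_norm :: "complex mat \<Rightarrow> real" where
  "frobenius_norm A = sqrt (\<Sum>i<dim_row A. \<Sum>j<dim_col A. (cmod (A $$ (i, j)))\<^sup>2)"

definition hermitian_mat :: "complex mat \<Rightarrow> bool" where
  "hermitian_mat A \<longleftrightarrow> square_mat A \<and> mat_adjoint A = A"

(* For Hermitian A the form v^H A v is real, so taking the real part loses nothing. *)

definition psd_mat :: "complex mat \<Rightarrow> bool" where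
  "psd_mat A \<longleftrightarrow> hermitian_mat A \<and>
     (\<forall>v\<in>carrier_vec (dim_row A). 0 \<le> Re ((A *\<^sub>v v) \<bullet>c v))"

definition posdef_mat :: "complex mat \<Rightarrow> bool" where
  "posdef_mat A \<longleftrightarrow> hermitian_mat A \<and>
     (\<forall>v\<in>carrier_vec (dim_row A). v \<noteq> 0\<^sub>v (dim_row A) \<longrightarrow> 0 < Re ((A *\<^sub>v v) \<bullet>c v))"

definition mat_rank :: "complex mat \<Rightarrow> nat" where
  "mat_rank A = vec_space.rank (dim_row A) A"

(* The four Penrose conditions, which determine X uniquely. *)

definition is_pseudoinverse :: "complex mat \<Rightarrow> complex mat \<Rightarrow> bool" where
  "is_pseudoinverse A X \<longleftrightarrow>
     X \<in> carrier_mat (dim_col A) (dim_row A) \<and>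
     A * X * A = A \<and> X * A * X = X \<and>
     mat_adjoint (A * X) = A * X \<and> mat_adjoint (X * A) = X * A"

definition pseudoinverse :: "complex mat \<Rightarrow> complex mat" where
  "pseudoinverse A = (THE X. is_pseudoinverse A X)"

(* Throughout, H r q is the channel from transmitter r to receiver q,
   of size nR q by nT r, and users are numbered 1, ..., Q. *)

definition strategy_set :: "(nat \<Rightarrow> nat) \<Rightarrow> (nat \<Rightarrow> real) \<Rightarrow> nat \<Rightarrow> complex mat set" where
  "strategy_set nT P q =
     {X \<in> carrier_mat (nT q) (nT q). psd_mat X \<and> mat_trace X = complex_of_real (P q)}"

definition strategy_profiles ::
  "nat \<Rightarrow> (nat \<Rightarrow> nat) \<Rightarrow> (nat \<Rightarrow> real) \<Rightarrow> (nat \<Rightarrow> complex mat) set" where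
  "strategy_profiles Q nT P = (\<Pi>\<^sub>E q\<in>{1..Q}. strategy_set nT P q)"

(* Matrices of varying size form no additive monoid, hence the entrywise sum. *)

definition interference_cov ::
  "nat \<Rightarrow> (nat \<Rightarrow> nat \<Rightarrow> complex mat) \<Rightarrow> (nat \<Rightarrow> complex mat) \<Rightarrow> nat
     \<Rightarrow> (nat \<Rightarrow> complex mat) \<Rightarrow> complex mat" where
  "interference_cov Q H Rn q X =
     mat (dim_row (Rn q)) (dim_col (Rn q)) (\<lambda>ij. Rn q $$ ij +
       (\<Sum>r\<in>{1..Q} - {q}. (H r q * X r * mat_adjoint (H r q)) $$ ij))"

definition reduced_eigendecomp ::
  "complex mat \<Rightarrow> nat \<Rightarrow> complex mat \<Rightarrow> (nat \<Rightarrow> real) \<Rightarrow> bool" where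
  "reduced_eigendecomp A r U d \<longleftrightarrow>
     U \<in> carrier_mat (dim_row A) r \<and> mat_adjoint U * U = 1\<^sub>m r \<and>
     (\<forall>i<r. 0 < d i) \<and>
     A = U * mat_diag r (\<lambda>i. complex_of_real (d i)) * mat_adjoint U"

definition waterfill_diag :: "nat \<Rightarrow> (nat \<Rightarrow> real) \<Rightarrow> real \<Rightarrow> complex mat" where
  "waterfill_diag r d \<mu> = mat_diag r (\<lambda>i. complex_of_real (max 0 (\<mu> - inverse (d i))))"

definition is_waterfilling ::
  "complex mat \<Rightarrow> nat \<Rightarrow> real \<Rightarrow> complex mat \<Rightarrow> bool" where
  "is_waterfilling A r p X \<longleftrightarrow>
     (\<exists>U d \<mu>. reduced_eigendecomp A r U d \<and>
        mat_trace (waterfill_diag r d \<mu>) = complex_of_real p \<and>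
        X = U * waterfill_diag r d \<mu> * mat_adjoint U)"

(* The eigendecomposition is not unique, but the resulting matrix is;
   THE refers to that common value. *)

definition waterfilling_user ::
  "nat \<Rightarrow> (nat \<Rightarrow> nat \<Rightarrow> complex mat) \<Rightarrow> (nat \<Rightarrow> complex mat) \<Rightarrow> (nat \<Rightarrow> real) \<Rightarrow> nat
     \<Rightarrow> (nat \<Rightarrow> complex mat) \<Rightarrow> complex mat" where
  "waterfilling_user Q H Rn P q X =
     (THE Y. is_waterfilling
        (mat_adjoint (H q q) * the (mat_inverse (interference_cov Q H Rn q X)) * H q q)
        (mat_rank (H q q)) (P q) Y)"

definition waterfilling ::
  "nat \<Rightarrow> (nat \<Rightarrow> nat \<Rightarrow> complex mat) \<Rightarrow> (nat \<Rightarrow> complex mat) \<Rightarrow> (nat \<Rightarrow> real)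
     \<Rightarrow> (nat \<Rightarrow> complex mat) \<Rightarrow> (nat \<Rightarrow> complex mat)" where
  "waterfilling Q H Rn P X = (\<lambda>q\<in>{1..Q}. waterfilling_user Q H Rn P q X)"

definition block_norm :: "nat \<Rightarrow> (nat \<Rightarrow> real) \<Rightarrow> (nat \<Rightarrow> complex mat) \<Rightarrow> real" where
  "block_norm Q w X = Max ((\<lambda>q. frobenius_norm (X q) / w q) ` {1..Q})"

definition block_dist ::
  "nat \<Rightarrow> (nat \<Rightarrow> real) \<Rightarrow> (nat \<Rightarrow> complex mat) \<Rightarrow> (nat \<Rightarrow> complex mat) \<Rightarrow> real" where
  "block_dist Q w X Y = block_norm Q w (\<lambda>q. X q - Y q)"

definition weighted_max_norm :: "nat \<Rightarrow> (nat \<Rightarrow> real) \<Rightarrow> (nat \<Rightarrow> nat \<Rightarrow> real) \<Rightarrow> real" where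
  "weighted_max_norm Q w A =
     Max ((\<lambda>q. 1 / w q * (\<Sum>r=1..Q. \<bar>A q r\<bar> * w r)) ` {1..Q})"

definition S_mat :: "(nat \<Rightarrow> nat \<Rightarrow> complex mat) \<Rightarrow> nat \<Rightarrow> nat \<Rightarrow> real" where
  "S_mat H q r = (if r = q then 0 else
     spectral_radius (mat_adjoint (H r q) * mat_adjoint (pseudoinverse (H q q))
                        * pseudoinverse (H q q) * H r q))"

definition contraction_with_modulus ::
  "('a \<Rightarrow> 'a \<Rightarrow> real) \<Rightarrow> 'a set \<Rightarrow> ('a \<Rightarrow> 'a) \<Rightarrow> real \<Rightarrow> bool" where
  "contraction_with_modulus d D T \<beta> \<longleftrightarrow>
     0 \<le> \<beta> \<and> \<beta> < 1 \<and> T \<in> D \<rightarrow> D \<and> (\<forall>x\<in>D. \<forall>y\<in>D. d (T x) (T y) \<le> \<beta> * d x y)"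

end

theory Submission
  imports Defs "HOL-Analysis.L2_Norm"
begin

text \<open>For \<open>A = H\<^sub>q\<^sub>q\<^sup>H R\<^sup>-\<^sup>1 H\<^sub>q\<^sub>q\<close> with pseudoinverse \<open>G\<close>, the waterfilling matrix \<open>Y\<close> satisfies the
  variational inequality \<open>\<langle>Y + G, Z - Y\<rangle> \<ge> 0\<close> for every other waterfilling output \<open>Z\<close> whose range
  lies in that of \<open>A\<close>. Adding this inequality to the one for \<open>Z\<close> and applying Cauchy-Schwarz shows that
  \<open>G \<mapsto> Y\<close> is nonexpansive in the Frobenius norm; the same argument gives uniqueness of \<open>Y\<close>.
  Full row rank makes \<open>G = K R K\<^sup>H\<close>, with \<open>K\<close> the pseudoinverse of \<open>H\<^sub>q\<^sub>q\<close>, and makes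
  \<open>A G = K H\<^sub>q\<^sub>q\<close> independent of \<open>R\<close>. So \<open>G\<close> is affine in the strategies of the other users, and
  the claim follows from \<open>\<parallel>L X L\<^sup>H\<parallel> \<le> \<rho>(L\<^sup>H L) \<parallel>X\<parallel>\<close> for \<open>L = K H\<^sub>r\<^sub>q\<close>.\<close>

section \<open>Adjoint, trace and the Frobenius inner product\<close>

text \<open>The variational inequality says that \<open>Y\<close> is the point nearest to
  \<open>-G\<close> in the convex set of positive semidefinite matrices of trace \<open>p\<close>
  supported on the range of \<open>A\<close>; the Lipschitz constant 1 is that of a projection onto
  a convex set. The difficulty in comparing two profiles is that their eigenbases and water levels
  are unrelated and the matrices need not commute, so the two closed formulas cannot be subtracted
  coefficient by coefficient. What the two cases do share is the range projector, and the inequality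
  relies on nothing else. A second obstacle is that \<open>waterfilling_user\<close> is a
  \<open>THE\<close> over eigendecompositions: its value is unknown until a reduced
  eigendecomposition and a water level are shown to exist. The decomposition is obtained by
  diagonalizing an invertible matrix of size \<open>nR q\<close>, so that zero eigenvalues never
  have to be split off. The factor rho(L^H L) is the squared operator norm of L, one power for each
  side of X.\<close>

lemma mat_adjoint_carrier [simp]:
  "A \<in> carrier_mat n m \<Longrightarrow> mat_adjoint A \<in> carrier_mat m n"
  unfolding mat_adjoint_def by auto

lemma mat_adjoint_dim [simp]:
  "dim_row (mat_adjoint A) = dim_col A" "dim_col (mat_adjoint A) = dim_row A"
  unfolding mat_adjoint_def by auto

lemma mat_adjoint_index [simp]:
  fixes A :: "complex mat"
  assumes "i < dim_col A" "j < dim_row A"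
  shows "mat_adjoint A $$ (i, j) = cnj (A $$ (j, i))"
  using assms unfolding mat_adjoint_def by (simp add: mat_of_rows_index)

text \<open>Side conditions that are equations between dimensions can be discharged by rewriting, so
  in this form associativity right-nests long products under simp.\<close>

lemma mult_assoc_dim:
  fixes A B C :: "complex mat"
  assumes "dim_col A = dim_row B" "dim_col B = dim_row C"
  shows "A * B * C = A * (B * C)"
  using assms by (metis assoc_mult_mat carrier_matI)

lemma mat_diag_dims [simp]: "dim_row (mat_diag n f) = n" "dim_col (mat_diag n f) = n"
  unfolding mat_diag_def by auto

lemma mult_index:
  assumes "A \<in> carrier_mat n m" "B \<in> carrier_mat m k" "i < n" "j < k"
  shows "(A * B) $$ (i, j) = (\<Sum>l<m. A $$ (i, l) * B $$ (l, j))"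
  using assms by (auto simp: scalar_prod_def atLeast0LessThan)

lemma mult_mat_vec_index:
  assumes "A \<in> carrier_mat n m" "v \<in> carrier_vec m" "i < n"
  shows "(A *\<^sub>v v) $ i = (\<Sum>l<m. A $$ (i, l) * v $ l)"
  using assms by (auto simp: scalar_prod_def atLeast0LessThan)

lemma cscalar_prod_index:
  fixes v w :: "complex vec"
  assumes "w \<in> carrier_vec n"
  shows "v \<bullet>c w = (\<Sum>i<n. v $ i * cnj (w $ i))"
  using assms by (auto simp: scalar_prod_def atLeast0LessThan)

lemma mat_adjoint_adjoint [simp]:
  fixes A :: "complex mat"
  shows "mat_adjoint (mat_adjoint A) = A"
  by (rule eq_matI) auto

lemma mat_adjoint_mult:
  fixes A B :: "complex mat"
  assumes "A \<in> carrier_mat n m" "B \<in> carrier_mat m k"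
  shows "mat_adjoint (A * B) = mat_adjoint B * mat_adjoint A"
proof (rule eq_matI)
  fix i j assume "i < dim_row (mat_adjoint B * mat_adjoint A)"
    "j < dim_col (mat_adjoint B * mat_adjoint A)"
  then have ij: "i < k" "j < n" using assms by auto
  have "(A * B) $$ (j, i) = (\<Sum>l<m. A $$ (j, l) * B $$ (l, i))"
    by (rule mult_index[OF assms ij(2,1)])
  moreover have "(mat_adjoint B * mat_adjoint A) $$ (i, j)
      = (\<Sum>l<m. mat_adjoint B $$ (i, l) * mat_adjoint A $$ (l, j))"
    by (rule mult_index[of _ k m _ n]) (use assms ij in auto)
  ultimately show "mat_adjoint (A * B) $$ (i, j) = (mat_adjoint B * mat_adjoint A) $$ (i, j)"
    using assms ij by (auto simp: mult.commute intro!: sum.cong)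
qed (use assms in auto)

lemma mat_adjoint_one [simp]: "mat_adjoint (1\<^sub>m n) = (1\<^sub>m n :: complex mat)"
  by (rule eq_matI) auto

lemma mat_adjoint_diag_real [simp]:
  "mat_adjoint (mat_diag n (\<lambda>i. complex_of_real (d i))) = mat_diag n (\<lambda>i. complex_of_real (d i))"
  by (rule eq_matI) (auto simp: mat_diag_def)

lemma mat_adjoint_cscalar:
  fixes A :: "complex mat"
  assumes A: "A \<in> carrier_mat n m" and v: "v \<in> carrier_vec m" and w: "w \<in> carrier_vec n"
  shows "(A *\<^sub>v v) \<bullet>c w = v \<bullet>c (mat_adjoint A *\<^sub>v w)"
proof -
  have "(A *\<^sub>v v) \<bullet>c w = (\<Sum>i<n. \<Sum>l<m. A $$ (i, l) * v $ l * cnj (w $ i))"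
    unfolding cscalar_prod_index[OF w] using mult_mat_vec_index[OF A v]
    by (auto simp: sum_distrib_right intro!: sum.cong)
  also have "\<dots> = (\<Sum>l<m. \<Sum>i<n. A $$ (i, l) * v $ l * cnj (w $ i))"
    by (rule sum.swap)
  also have "\<dots> = v \<bullet>c (mat_adjoint A *\<^sub>v w)"
  proof -
    have "mat_adjoint A *\<^sub>v w \<in> carrier_vec m"
      using A w by (metis mat_adjoint_carrier mult_mat_vec_carrier)
    from cscalar_prod_index[OF this] show ?thesis
      using mult_mat_vec_index[OF mat_adjoint_carrier[OF A] w] A
      by (auto simp: sum_distrib_left mult_ac intro!: sum.cong)
  qed
  finally show ?thesis .
qed

lemma cscalar_prod_self:
  fixes v :: "complex vec"
  assumes "v \<in> carrier_vec n"
  shows "v \<bullet>c v = complex_of_real (\<Sum>i<n. (cmod (v $ i))\<^sup>2)"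
  unfolding cscalar_prod_index[OF assms] of_real_sum
  by (auto simp: complex_mult_cnj cmod_power2 intro!: sum.cong)

lemma cscalar_prod_self_pos:
  fixes v :: "complex vec"
  assumes "v \<in> carrier_vec n" "v \<noteq> 0\<^sub>v n"
  shows "0 < Re (v \<bullet>c v)"
proof -
  obtain i where "i < n" "v $ i \<noteq> 0" using assms by (metis eq_vecI carrier_vecD index_zero_vec)
  then have "0 < (\<Sum>i<n. (cmod (v $ i))\<^sup>2)"
    by (intro sum_pos2[where i = i]) auto
  then show ?thesis unfolding cscalar_prod_self[OF assms(1)] by simp
qed

lemma mat_trace_comm:
  assumes A: "A \<in> carrier_mat n m" and B: "B \<in> carrier_mat m n"
  shows "mat_trace (A * B) = mat_trace (B * A)"
proof -
  have "mat_trace (A * B) = (\<Sum>i<n. \<Sum>l<m. A $$ (i, l) * B $$ (l, i))"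
    unfolding mat_trace_def using A mult_index[OF A B] by (auto intro!: sum.cong)
  also have "\<dots> = (\<Sum>l<m. \<Sum>i<n. B $$ (l, i) * A $$ (i, l))"
    by (subst sum.swap) (simp add: mult.commute)
  also have "\<dots> = mat_trace (B * A)"
    unfolding mat_trace_def using B mult_index[OF B A] by (auto intro!: sum.cong)
  finally show ?thesis .
qed

text \<open>Keeping only the real part makes the form symmetric on all matrices and turns them into
  a real Euclidean space, which is the setting of the projection argument.\<close>

definition frob_inner :: "complex mat \<Rightarrow> complex mat \<Rightarrow> real" where
  "frob_inner A B = Re (mat_trace (A * mat_adjoint B))"

lemma frob_inner_index:
  assumes A: "A \<in> carrier_mat n m" and B: "B \<in> carrier_mat n m"
  shows "frob_inner A B = (\<Sum>i<n. \<Sum>j<m. Re (A $$ (i, j) * cnj (B $$ (i, j))))"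
proof -
  have "mat_trace (A * mat_adjoint B) = (\<Sum>i<n. \<Sum>j<m. A $$ (i, j) * cnj (B $$ (i, j)))"
    unfolding mat_trace_def using A B mult_index[OF A mat_adjoint_carrier[OF B]]
    by (auto intro!: sum.cong)
  then show ?thesis unfolding frob_inner_def by simp
qed

lemma frob_inner_commute:
  assumes A: "A \<in> carrier_mat n m" and B: "B \<in> carrier_mat n m"
  shows "frob_inner A B = frob_inner B A"
  unfolding frob_inner_index[OF A B] frob_inner_index[OF B A]
  by (intro sum.cong refl) (simp add: mult.commute)

lemma frob_inner_diff_left:
  assumes A: "A \<in> carrier_mat n m" and B: "B \<in> carrier_mat n m" and C: "C \<in> carrier_mat n m"
  shows "frob_inner (A - B) C = frob_inner A C - frob_inner B C"
proof -
  have AB: "A - B \<in> carrier_mat n m" using A B by auto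
  have "frob_inner (A - B) C
      = (\<Sum>i<n. \<Sum>j<m. Re (A $$ (i, j) * cnj (C $$ (i, j))) - Re (B $$ (i, j) * cnj (C $$ (i, j))))"
    unfolding frob_inner_index[OF AB C]
    by (intro sum.cong refl) (use A B in \<open>simp add: algebra_simps\<close>)
  then show ?thesis
    unfolding frob_inner_index[OF A C] frob_inner_index[OF B C] sum_subtractf .
qed

text \<open>Flattening a matrix into a family indexed by pairs lets Cauchy-Schwarz and the triangle
  inequality be inherited from \<open>L2_set\<close>.\<close>

lemma frobenius_norm_L2_set:
  assumes "A \<in> carrier_mat n m"
  shows "frobenius_norm A = L2_set (\<lambda>p. cmod (A $$ p)) ({..<n} \<times> {..<m})"
  using assms unfolding frobenius_norm_def L2_set_def
  by (simp add: sum.cartesian_product case_prod_beta)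

lemma frobenius_norm_nonneg [simp]: "0 \<le> frobenius_norm A"
  unfolding frobenius_norm_def by (simp add: sum_nonneg)

lemma frobenius_norm_square:
  assumes "A \<in> carrier_mat n m"
  shows "(frobenius_norm A)\<^sup>2 = frob_inner A A"
proof -
  have "(frobenius_norm A)\<^sup>2 = (\<Sum>i<n. \<Sum>j<m. (cmod (A $$ (i, j)))\<^sup>2)"
    using assms unfolding frobenius_norm_def by (simp add: sum_nonneg)
  also have "\<dots> = frob_inner A A"
    unfolding frob_inner_index[OF assms assms]
    by (intro sum.cong refl) (simp add: cmod_power2, simp add: power2_eq_square)
  finally show ?thesis .
qed

lemma frobenius_norm_adjoint [simp]: "frobenius_norm (mat_adjoint A) = frobenius_norm A"
  unfolding frobenius_norm_def by (subst sum.swap) (auto intro!: sum.cong)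

lemma frobenius_norm_eq_0D:
  assumes A: "A \<in> carrier_mat n m" and "frobenius_norm A \<le> 0"
  shows "A = 0\<^sub>m n m"
proof -
  have "frobenius_norm A = 0" using assms(2) frobenius_norm_nonneg[of A] by linarith
  then show ?thesis unfolding frobenius_norm_L2_set[OF A]
    by (intro eq_matI) (use A in \<open>auto simp: L2_set_eq_0_iff\<close>)
qed

lemma frob_inner_le:
  assumes A: "A \<in> carrier_mat n m" and B: "B \<in> carrier_mat n m"
  shows "frob_inner A B \<le> frobenius_norm A * frobenius_norm B"
proof -
  have "frob_inner A B = (\<Sum>p\<in>{..<n} \<times> {..<m}. Re (A $$ p * cnj (B $$ p)))"
    unfolding frob_inner_index[OF A B] by (simp add: sum.cartesian_product case_prod_beta)
  also have "\<dots> \<le> (\<Sum>p\<in>{..<n} \<times> {..<m}. \<bar>cmod (A $$ p)\<bar> * \<bar>cmod (B $$ p)\<bar>)"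
    by (intro sum_mono, rule order.trans[OF complex_Re_le_cmod]) (simp add: norm_mult)
  also have "\<dots> \<le> frobenius_norm A * frobenius_norm B"
    unfolding frobenius_norm_L2_set[OF A] frobenius_norm_L2_set[OF B] by (rule L2_set_mult_ineq)
  finally show ?thesis .
qed

lemma frobenius_norm_add:
  assumes A: "A \<in> carrier_mat n m" and B: "B \<in> carrier_mat n m"
  shows "frobenius_norm (A + B) \<le> frobenius_norm A + frobenius_norm B"
proof -
  have AB: "A + B \<in> carrier_mat n m" using A B by auto
  have "frobenius_norm (A + B)
      \<le> L2_set (\<lambda>p. cmod (A $$ p) + cmod (B $$ p)) ({..<n} \<times> {..<m})"
    unfolding frobenius_norm_L2_set[OF AB]
    by (rule L2_set_mono) (use A B in \<open>auto simp: norm_triangle_ineq\<close>)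
  also have "\<dots> \<le> frobenius_norm A + frobenius_norm B"
    unfolding frobenius_norm_L2_set[OF A] frobenius_norm_L2_set[OF B] by (rule L2_set_triangle_ineq)
  finally show ?thesis .
qed

lemma frobenius_norm_entrywise_sum:
  assumes "finite I" "\<And>r. r \<in> I \<Longrightarrow> M r \<in> carrier_mat n m"
  shows "frobenius_norm (mat n m (\<lambda>p. \<Sum>r\<in>I. M r $$ p)) \<le> (\<Sum>r\<in>I. frobenius_norm (M r))"
  using assms
proof (induction I)
  case empty
  then show ?case by (simp add: frobenius_norm_def)
next
  case (insert s I)
  have "mat n m (\<lambda>p. \<Sum>r\<in>insert s I. M r $$ p) = M s + mat n m (\<lambda>p. \<Sum>r\<in>I. M r $$ p)"
    by (rule eq_matI) (use insert in auto)
  also have "frobenius_norm \<dots> \<le> frobenius_norm (M s) + frobenius_norm (mat n m (\<lambda>p. \<Sum>r\<in>I. M r $$ p))"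
    by (rule frobenius_norm_add[of _ n m]) (use insert in auto)
  finally show ?case using insert by auto
qed

section \<open>Unitary diagonalization of Hermitian matrices\<close>

text \<open>Gram-Schmidt on a basis completed from \<open>v\<close> keeps \<open>v\<close> as its
  first vector. Normalizing the columns rescales it, hence the factor \<open>c\<close>.\<close>

lemma unitary_first_column:
  fixes v :: "complex vec"
  assumes v: "v \<in> carrier_vec n" "v \<noteq> 0\<^sub>v n"
  obtains W c where "W \<in> carrier_mat n n" "mat_adjoint W * W = 1\<^sub>m n" "\<forall>i<n. W $$ (i, 0) = c * v $ i"
proof -
  define ws where "ws = gram_schmidt n (basis_completion v)"
  note bc = vec_space.basis_completion[OF v]
  interpret cof_vec_space n "TYPE(complex)" .
  note gs = gram_schmidt_result[OF bc(2,4,5) ws_def]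
  have len: "length ws = n" using gs(4) bc(6) by simp
  have n0: "0 < n" using v by (cases n) auto
  have "ws ! 0 = v"
  proof -
    have "hd ws = v"
      unfolding ws_def using v(1) by (simp add: basis_completion_def Let_def)
    then show ?thesis using len n0 by (metis hd_conv_nth length_greater_0_conv)
  qed
  have wc: "ws ! i \<in> carrier_vec n" if "i < n" for i using gs(3) len that by force
  define \<nu> where "\<nu> i = sqrt (Re (ws ! i \<bullet>c ws ! i))" for i
  have \<nu>: "0 < \<nu> i" "ws ! i \<bullet>c ws ! i = complex_of_real (\<nu> i) * complex_of_real (\<nu> i)" if i: "i < n" for i
  proof -
    have "ws ! i \<bullet>c ws ! i \<noteq> 0" using corthogonalD[OF gs(2), of i i] len i by auto
    then have nz: "ws ! i \<noteq> 0\<^sub>v n" by (metis conjugate_square_eq_0_vec wc[OF i])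
    then have pos: "0 < Re (ws ! i \<bullet>c ws ! i)" using cscalar_prod_self_pos[OF wc[OF i]] by simp
    then show "0 < \<nu> i" unfolding \<nu>_def by simp
    have "\<nu> i * \<nu> i = Re (ws ! i \<bullet>c ws ! i)" unfolding \<nu>_def using pos by simp
    moreover have "ws ! i \<bullet>c ws ! i = complex_of_real (Re (ws ! i \<bullet>c ws ! i))"
      using cscalar_prod_self[OF wc[OF i]] by simp
    ultimately show "ws ! i \<bullet>c ws ! i = complex_of_real (\<nu> i) * complex_of_real (\<nu> i)"
      by (metis of_real_mult)
  qed
  define W where "W = mat n n (\<lambda>(i, j). ws ! j $ i / complex_of_real (\<nu> j))"
  have W: "W \<in> carrier_mat n n" unfolding W_def by simp
  have "mat_adjoint W * W = 1\<^sub>m n"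
  proof (rule eq_matI)
    fix i j assume "i < dim_row (1\<^sub>m n :: complex mat)" "j < dim_col (1\<^sub>m n :: complex mat)"
    then have ij: "i < n" "j < n" by auto
    have "(mat_adjoint W * W) $$ (i, j) = (\<Sum>l<n. mat_adjoint W $$ (i, l) * W $$ (l, j))"
      by (rule mult_index[OF _ W ij]) (use W in auto)
    also have "\<dots> = (\<Sum>l<n. ws ! j $ l * cnj (ws ! i $ l)) / (complex_of_real (\<nu> i) * complex_of_real (\<nu> j))"
      unfolding sum_divide_distrib by (rule sum.cong) (use W ij in \<open>auto simp: W_def\<close>)
    also have "\<dots> = (ws ! j \<bullet>c ws ! i) / (complex_of_real (\<nu> i) * complex_of_real (\<nu> j))"
      unfolding cscalar_prod_index[OF wc[OF ij(1)]] ..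
    also have "\<dots> = (if i = j then 1 else 0)"
      using corthogonalD[OF gs(2), of j i] len ij \<nu>[OF ij(1)] by auto
    finally show "(mat_adjoint W * W) $$ (i, j) = 1\<^sub>m n $$ (i, j)" using ij by simp
  qed (use W in auto)
  moreover have "\<forall>i<n. W $$ (i, 0) = 1 / complex_of_real (\<nu> 0) * v $ i"
    using n0 \<open>ws ! 0 = v\<close> unfolding W_def by auto
  ultimately show ?thesis using that W by blast
qed

text \<open>Deflation: once an eigenvector is the first basis vector, column 0 vanishes below the
  diagonal. Hermitian symmetry then clears row 0 and makes the eigenvalue real, and what remains is
  a Hermitian block one size smaller.\<close>

lemma hermitian_unitary_diagonalization:
  assumes "A \<in> carrier_mat n n" "mat_adjoint A = A"
  shows "\<exists>V d. V \<in> carrier_mat n n \<and> mat_adjoint V * V = 1\<^sub>m n \<and>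
    A = V * mat_diag n (\<lambda>i. complex_of_real (d i)) * mat_adjoint V"
  using assms
proof (induction n arbitrary: A)
  case 0
  then show ?case by (intro exI[of _ "1\<^sub>m 0"] exI[of _ "\<lambda>_. 0"]) auto
next
  case (Suc m)
  let ?n = "Suc m"
  note A = Suc.prems(1)
  have AH[simp]: "mat_adjoint A = A" by (rule Suc.prems(2))
  obtain l v where v: "v \<in> carrier_vec ?n" "v \<noteq> 0\<^sub>v ?n" and ev: "A *\<^sub>v v = l \<cdot>\<^sub>v v"
    using spectrum_non_empty[OF A] A unfolding spectrum_def eigenvalue_def eigenvector_def by auto
  obtain W c where W: "W \<in> carrier_mat ?n ?n" and WW: "mat_adjoint W * W = 1\<^sub>m ?n"
    and W0: "\<forall>i<?n. W $$ (i, 0) = c * v $ i"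
    using unitary_first_column[OF v] by blast
  have WH: "mat_adjoint W \<in> carrier_mat ?n ?n" using W by simp
  have WW': "W * mat_adjoint W = 1\<^sub>m ?n" by (rule mat_mult_left_right_inverse[OF WH W WW])
  define B where "B = mat_adjoint W * (A * W)"
  have B: "B \<in> carrier_mat ?n ?n" unfolding B_def using WH A W by auto
  have BH: "mat_adjoint B = B"
  proof -
    have "mat_adjoint B = mat_adjoint (A * W) * mat_adjoint (mat_adjoint W)"
      unfolding B_def by (rule mat_adjoint_mult[of _ ?n ?n _ ?n]) (use WH A W in auto)
    also have "mat_adjoint (A * W) = mat_adjoint W * A"
      using mat_adjoint_mult[OF A W] by simp
    finally show ?thesis unfolding B_def using assoc_mult_mat[OF WH A W] by simp
  qed
  \<comment> \<open>Column 0 of \<open>W\<close> is an eigenvector of \<open>A\<close>, so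
    \<open>A * W\<close> has \<open>l\<close> times that column in the same place, and
    orthonormality of the columns leaves only the entry at 0.\<close>
  have B0: "B $$ (i, 0) = (if i = 0 then l else 0)" if i: "i < ?n" for i
  proof -
    have AW: "(A * W) $$ (j, 0) = l * W $$ (j, 0)" if j: "j < ?n" for j
    proof -
      have "(A * W) $$ (j, 0) = (\<Sum>k<?n. A $$ (j, k) * W $$ (k, 0))"
        by (rule mult_index[OF A W j]) simp
      also have "\<dots> = c * (\<Sum>k<?n. A $$ (j, k) * v $ k)"
        unfolding sum_distrib_left by (rule sum.cong) (use W0 in auto)
      also have "(\<Sum>k<?n. A $$ (j, k) * v $ k) = l * v $ j"
        unfolding mult_mat_vec_index[OF A v(1) j, symmetric] ev using v j by simp
      finally show ?thesis using W0 j by simp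
    qed
    have "B $$ (i, 0) = (\<Sum>k<?n. mat_adjoint W $$ (i, k) * (A * W) $$ (k, 0))"
      unfolding B_def by (rule mult_index[OF WH _ i]) (use A W in auto)
    also have "\<dots> = l * (\<Sum>k<?n. mat_adjoint W $$ (i, k) * W $$ (k, 0))"
      unfolding sum_distrib_left by (rule sum.cong) (simp_all add: AW)
    also have "(\<Sum>k<?n. mat_adjoint W $$ (i, k) * W $$ (k, 0)) = (mat_adjoint W * W) $$ (i, 0)"
      by (rule mult_index[OF WH W i, symmetric]) simp
    finally show ?thesis unfolding WW using i by simp
  qed
  have Bsym: "B $$ (i, j) = cnj (B $$ (j, i))" if "i < ?n" "j < ?n" for i j
    using mat_adjoint_index[of i B j] that B unfolding BH by simp
  have lr: "l = complex_of_real (Re l)"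
    using Bsym[of 0 0] B0[of 0] by (simp add: complex_eq_iff)
  define B' where "B' = mat m m (\<lambda>(i, j). B $$ (Suc i, Suc j))"
  have B': "B' \<in> carrier_mat m m" unfolding B'_def by simp
  have "mat_adjoint B' = B'"
  proof (rule eq_matI)
    fix i j assume "i < dim_row B'" "j < dim_col B'"
    then have "i < m" "j < m" using B' by auto
    then show "mat_adjoint B' $$ (i, j) = B' $$ (i, j)"
      using B' Bsym[of "Suc i" "Suc j"] by (simp add: B'_def)
  qed (use B' in auto)
  from Suc.IH[OF B' this] obtain V d where V: "V \<in> carrier_mat m m"
    and VV: "mat_adjoint V * V = 1\<^sub>m m"
    and BV: "B' = V * mat_diag m (\<lambda>i. complex_of_real (d i)) * mat_adjoint V" by blast
  \<comment> \<open>Direct sum of a scalar and a matrix. It respects products, adjoints and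
    identities, which lifts the diagonalization of \<open>B'\<close> to \<open>B\<close>.\<close>
  define blk where "blk x M = four_block_mat (mat 1 1 (\<lambda>_. x)) (0\<^sub>m 1 m) (0\<^sub>m m 1) M"
    for x :: complex and M :: "complex mat"
  have blk: "blk x M \<in> carrier_mat ?n ?n" if "M \<in> carrier_mat m m" for x M
    using that unfolding blk_def by auto
  have blk_mult: "blk x M * blk y N = blk (x * y) (M * N)"
    if "M \<in> carrier_mat m m" "N \<in> carrier_mat m m" for x y M N
  proof -
    have "mat 1 1 (\<lambda>_. x) * mat 1 1 (\<lambda>_. y) = mat 1 1 (\<lambda>_. x * y)"
      by (rule eq_matI) (auto simp: scalar_prod_def)
    then show ?thesis unfolding blk_def
      by (subst mult_four_block_mat[of _ 1 1 _ m _ m _ _ 1 _ m]) (use that in auto)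
  qed
  have blk_adj: "mat_adjoint (blk x M) = blk (cnj x) (mat_adjoint M)"
    if "M \<in> carrier_mat m m" for x M
    by (rule eq_matI) (use that in \<open>auto simp: blk_def\<close>)
  have blk_one: "blk 1 (1\<^sub>m m) = 1\<^sub>m ?n"
    by (rule eq_matI) (auto simp: blk_def)
  let ?d = "\<lambda>i. case i of 0 \<Rightarrow> Re l | Suc j \<Rightarrow> d j"
  have blk_diag: "blk l (mat_diag m (\<lambda>i. complex_of_real (d i))) = mat_diag ?n (\<lambda>i. complex_of_real (?d i))"
    by (rule eq_matI) (use lr in \<open>auto simp: blk_def mat_diag_def split: nat.splits\<close>)
  have "B = blk l B'"
  proof (rule eq_matI)
    fix i j assume "i < dim_row (blk l B')" "j < dim_col (blk l B')"
    then have ij: "i < ?n" "j < ?n" using blk[OF B', of l] by auto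
    show "B $$ (i, j) = blk l B' $$ (i, j)"
    proof (cases "j = 0")
      case True
      then show ?thesis using ij B0[OF ij(1)] B' by (auto simp: blk_def)
    next
      case False
      then show ?thesis using ij B' Bsym[of 0 j] B0[OF ij(2)]
        by (cases i; cases j) (auto simp: blk_def B'_def)
    qed
  qed (use B blk[OF B', of l] in auto)
  also have "\<dots> = blk 1 V * mat_diag ?n (\<lambda>i. complex_of_real (?d i)) * blk 1 (mat_adjoint V)"
    unfolding blk_diag[symmetric] BV
    by (subst blk_mult; (subst blk_mult)?) (use V in \<open>auto simp: mat_diag_dim\<close>)
  finally have BD: "B = blk 1 V * mat_diag ?n (\<lambda>i. complex_of_real (?d i)) * blk 1 (mat_adjoint V)" .
  let ?U = "blk 1 V" and ?D = "mat_diag ?n (\<lambda>i. complex_of_real (?d i))"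
  have U: "?U \<in> carrier_mat ?n ?n" by (rule blk[OF V])
  have UH: "mat_adjoint ?U = blk 1 (mat_adjoint V)" by (simp add: blk_adj[OF V])
  have UU: "mat_adjoint ?U * ?U = 1\<^sub>m ?n"
    unfolding UH by (subst blk_mult) (use V in \<open>auto simp: VV blk_one\<close>)
  have UHc: "mat_adjoint ?U \<in> carrier_mat ?n ?n" using U by simp
  have WU: "W * ?U \<in> carrier_mat ?n ?n" using W U by auto
  have WUH: "mat_adjoint (W * ?U) = mat_adjoint ?U * mat_adjoint W"
    by (rule mat_adjoint_mult[OF W U])
  have "mat_adjoint (W * ?U) * (W * ?U) = mat_adjoint ?U * (mat_adjoint W * W) * ?U"
    unfolding WUH using carrier_matD[OF W] carrier_matD[OF U] by (simp add: mult_assoc_dim)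
  then have 1: "mat_adjoint (W * ?U) * (W * ?U) = 1\<^sub>m ?n" unfolding WW right_mult_one_mat[OF UHc] UU .
  have "A = (W * mat_adjoint W) * A * (W * mat_adjoint W)" unfolding WW' using A by simp
  also have "\<dots> = W * B * mat_adjoint W"
    unfolding B_def using carrier_matD[OF W] carrier_matD[OF A] by (simp add: mult_assoc_dim)
  also have "\<dots> = W * ?U * ?D * mat_adjoint (W * ?U)"
    unfolding BD UH[symmetric] WUH
    using carrier_matD[OF W] carrier_matD[OF U] by (simp add: mult_assoc_dim)
  finally show ?case using 1 WU by blast
qed

section \<open>Waterfilling as the solution of a variational inequality\<close>

text \<open>Functional calculus on a fixed orthonormal family of columns: products, traces and inner
  products reduce to the coefficients \<open>e\<close>. As \<open>U\<close> need not be square,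
  constant coefficients 1 give the projector onto its range and not the identity.\<close>

definition spectral_mat :: "complex mat \<Rightarrow> nat \<Rightarrow> (nat \<Rightarrow> real) \<Rightarrow> complex mat" where
  "spectral_mat U r e = U * mat_diag r (\<lambda>i. complex_of_real (e i)) * mat_adjoint U"

lemma spectral_mat_carrier [simp]:
  "U \<in> carrier_mat n r \<Longrightarrow> spectral_mat U r e \<in> carrier_mat n n"
  unfolding spectral_mat_def using mat_diag_dim[of r "\<lambda>i. complex_of_real (e i)"]
  by (metis mat_adjoint_carrier mult_carrier_mat)

lemma spectral_mat_adjoint:
  assumes U: "U \<in> carrier_mat n r"
  shows "mat_adjoint (spectral_mat U r e) = spectral_mat U r e"
proof -
  let ?D = "mat_diag r (\<lambda>i. complex_of_real (e i))"
  have D: "?D \<in> carrier_mat r r" by (rule mat_diag_dim)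
  have UD: "U * ?D \<in> carrier_mat n r" using U D by auto
  have "mat_adjoint (spectral_mat U r e) = U * (?D * mat_adjoint U)"
    unfolding spectral_mat_def mat_adjoint_mult[OF UD mat_adjoint_carrier[OF U]]
      mat_adjoint_mult[OF U D] by simp
  then show ?thesis
    unfolding spectral_mat_def using assoc_mult_mat[OF U D mat_adjoint_carrier[OF U]] by simp
qed

lemma spectral_mat_mult:
  assumes U: "U \<in> carrier_mat n r" and UU: "mat_adjoint U * U = 1\<^sub>m r"
  shows "spectral_mat U r e * spectral_mat U r f = spectral_mat U r (\<lambda>i. e i * f i)"
proof -
  let ?E = "mat_diag r (\<lambda>i. complex_of_real (e i))" and ?F = "mat_diag r (\<lambda>i. complex_of_real (f i))"
  have E: "?E \<in> carrier_mat r r" and F: "?F \<in> carrier_mat r r" by (rule mat_diag_dim)+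
  have UH: "mat_adjoint U \<in> carrier_mat r n" using U by simp
  have UE: "U * ?E \<in> carrier_mat n r" and UF: "U * ?F \<in> carrier_mat n r" using U E F by auto
  have "spectral_mat U r e * spectral_mat U r f = U * ?E * (mat_adjoint U * U * ?F) * mat_adjoint U"
    unfolding spectral_mat_def using carrier_matD[OF U] carrier_matD[OF E] carrier_matD[OF F]
    by (simp add: mult_assoc_dim)
  also have "\<dots> = U * (?E * ?F) * mat_adjoint U"
    unfolding UU left_mult_one_mat[OF F] assoc_mult_mat[OF U E F] ..
  finally show ?thesis unfolding spectral_mat_def by simp
qed

lemma spectral_mat_one:
  assumes "U \<in> carrier_mat n r"
  shows "spectral_mat U r (\<lambda>_. 1) = U * mat_adjoint U"
  unfolding spectral_mat_def using assms by simp

lemma mat_trace_diag: "mat_trace (mat_diag r (\<lambda>i. complex_of_real (e i))) = complex_of_real (\<Sum>i<r. e i)"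
  unfolding mat_trace_def by (simp add: mat_diag_def)

lemma mat_trace_spectral_mat:
  assumes U: "U \<in> carrier_mat n r" and UU: "mat_adjoint U * U = 1\<^sub>m r"
  shows "mat_trace (spectral_mat U r e) = complex_of_real (\<Sum>i<r. e i)"
proof -
  let ?D = "mat_diag r (\<lambda>i. complex_of_real (e i))"
  have D: "?D \<in> carrier_mat r r" by (rule mat_diag_dim)
  have UH: "mat_adjoint U \<in> carrier_mat r n" using U by simp
  have UD: "U * ?D \<in> carrier_mat n r" using U D by auto
  have "mat_trace (spectral_mat U r e) = mat_trace (mat_adjoint U * (U * ?D))"
    unfolding spectral_mat_def by (rule mat_trace_comm[OF UD UH])
  also have "mat_adjoint U * (U * ?D) = ?D"
    using assoc_mult_mat[OF UH U D] UU left_mult_one_mat[OF D] by simp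
  finally show ?thesis by (simp add: mat_trace_diag)
qed

text \<open>Cyclicity of the trace gathers both bases in the overlap matrix \<open>T\<close>. The
  weights are squared moduli, hence nonnegative, so inequalities between coefficients carry over
  term by term even when the two matrices do not commute.\<close>

lemma frob_inner_spectral_mat:
  assumes U: "U \<in> carrier_mat n r" and U': "U' \<in> carrier_mat n r'"
  shows "frob_inner (spectral_mat U r e) (spectral_mat U' r' e')
    = (\<Sum>i<r. \<Sum>j<r'. e i * e' j * (cmod ((mat_adjoint U * U') $$ (i, j)))\<^sup>2)"
proof -
  let ?E = "mat_diag r (\<lambda>i. complex_of_real (e i))" and ?F = "mat_diag r' (\<lambda>i. complex_of_real (e' i))"
  have E: "?E \<in> carrier_mat r r" and F: "?F \<in> carrier_mat r' r'" by (rule mat_diag_dim)+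
  have UH: "mat_adjoint U \<in> carrier_mat r n" and UH': "mat_adjoint U' \<in> carrier_mat r' n"
    using U U' by auto
  define T where "T = mat_adjoint U * U'"
  have T: "T \<in> carrier_mat r r'" unfolding T_def using UH U' by auto
  have TH: "mat_adjoint T = mat_adjoint U' * U"
    unfolding T_def mat_adjoint_mult[OF UH U'] by simp
  have ET: "?E * T \<in> carrier_mat r r'" and FT: "?F * mat_adjoint T \<in> carrier_mat r' r"
    using mult_carrier_mat[OF E T] mult_carrier_mat[OF F mat_adjoint_carrier[OF T]] by auto
  have "frob_inner (spectral_mat U r e) (spectral_mat U' r' e')
      = Re (mat_trace (U * (?E * (T * (?F * mat_adjoint U')))))"
    unfolding frob_inner_def spectral_mat_adjoint[OF U'] unfolding spectral_mat_def T_def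
    using carrier_matD[OF U] carrier_matD[OF U'] carrier_matD[OF E] carrier_matD[OF F]
    by (simp add: mult_assoc_dim)
  also have "mat_trace (U * (?E * (T * (?F * mat_adjoint U'))))
      = mat_trace ((?E * (T * (?F * mat_adjoint U'))) * U)"
    by (rule mat_trace_comm[OF U mult_carrier_mat[OF E mult_carrier_mat[OF T mult_carrier_mat[OF F UH']]]])
  also have "(?E * (T * (?F * mat_adjoint U'))) * U = (?E * T) * (?F * mat_adjoint T)"
    unfolding TH
    using carrier_matD[OF U] carrier_matD[OF U'] carrier_matD[OF E] carrier_matD[OF F] carrier_matD[OF T]
    by (simp add: mult_assoc_dim)
  also have "mat_trace \<dots> = (\<Sum>i<r. \<Sum>j<r'. (?E * T) $$ (i, j) * (?F * mat_adjoint T) $$ (j, i))"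
    unfolding mat_trace_def using ET mult_index[OF ET FT] by (auto intro!: sum.cong)
  also have "\<dots> = (\<Sum>i<r. \<Sum>j<r'. complex_of_real (e i * e' j * (cmod (T $$ (i, j)))\<^sup>2))"
  proof (intro sum.cong refl)
    fix i j assume ij: "i \<in> {..<r}" "j \<in> {..<r'}"
    have "(?E * T) $$ (i, j) = e i * T $$ (i, j)"
      unfolding mat_diag_mult_left[OF T] using ij by simp
    moreover have "(?F * mat_adjoint T) $$ (j, i) = e' j * cnj (T $$ (i, j))"
      unfolding mat_diag_mult_left[OF mat_adjoint_carrier[OF T]] using ij T by simp
    ultimately show "(?E * T) $$ (i, j) * (?F * mat_adjoint T) $$ (j, i)
        = complex_of_real (e i * e' j * (cmod (T $$ (i, j)))\<^sup>2)"
      by (simp add: complex_norm_square mult_ac del: of_real_power)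
  qed
  finally show ?thesis unfolding T_def by simp
qed

lemma frob_inner_spectral_mat_same:
  assumes U: "U \<in> carrier_mat n r" and UU: "mat_adjoint U * U = 1\<^sub>m r"
  shows "frob_inner (spectral_mat U r e) (spectral_mat U r e') = (\<Sum>i<r. e i * e' i)"
proof -
  have "frob_inner (spectral_mat U r e) (spectral_mat U r e')
    = (\<Sum>i<r. \<Sum>j<r. if i = j then e i * e' i else 0)"
    unfolding frob_inner_spectral_mat[OF U U] UU by (intro sum.cong refl) auto
  then show ?thesis by simp
qed

text \<open>The coefficients of \<open>Y + G\<close> are \<open>max \<mu> (g i) \<ge> \<mu>\<close>, with equality where \<open>Y\<close> is nonzero. Hence
  \<open>\<langle>Y + G, Z\<rangle> \<ge> \<mu> p\<close> for every \<open>Z\<close> of trace \<open>p\<close> on the same range, and \<open>Y\<close> attains the bound.\<close>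

lemma waterfill_variational:
  assumes U: "U \<in> carrier_mat n r" and UU: "mat_adjoint U * U = 1\<^sub>m r"
    and U': "U' \<in> carrier_mat n r'" and UU': "mat_adjoint U' * U' = 1\<^sub>m r'"
    and range: "U * mat_adjoint U = U' * mat_adjoint U'"
    and y: "\<And>i. i < r \<Longrightarrow> y i = max 0 (\<mu> - g i)" "(\<Sum>i<r. y i) = p"
    and z: "\<And>i. i < r' \<Longrightarrow> 0 \<le> z i" "(\<Sum>i<r'. z i) = p"
  defines "Y \<equiv> spectral_mat U r y" and "G \<equiv> spectral_mat U r g" and "Z \<equiv> spectral_mat U' r' z"
  shows "frob_inner Y Y + frob_inner G Y \<le> frob_inner Y Z + frob_inner G Z"
proof -
  have yg: "(y i + g i) * y i = \<mu> * y i" "\<mu> \<le> y i + g i" if "i < r" for i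
    using y(1)[OF that] by (auto simp: max_def)
  have "frob_inner Y Y + frob_inner G Y = (\<Sum>i<r. (y i + g i) * y i)"
    unfolding Y_def G_def frob_inner_spectral_mat_same[OF U UU]
    by (simp add: algebra_simps sum.distrib)
  also have "\<dots> = (\<Sum>i<r. \<mu> * y i)"
    by (rule sum.cong) (use yg in auto)
  also have "\<dots> = \<mu> * p" using y(2) by (simp add: sum_distrib_left[symmetric])
  \<comment> \<open>The trace \<open>p\<close> of \<open>Z\<close> is its pairing with the projector
    of its own range. Replacing that projector by the one of \<open>U\<close> puts both sides over
    the same overlap weights; this is where the common range enters.\<close>
  also have "\<dots> = \<mu> * frob_inner (spectral_mat U' r' (\<lambda>_. 1)) Z"
    unfolding Z_def frob_inner_spectral_mat_same[OF U' UU'] using z(2) by simp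
  also have "spectral_mat U' r' (\<lambda>_. 1) = spectral_mat U r (\<lambda>_. 1)"
    unfolding spectral_mat_one[OF U] spectral_mat_one[OF U'] range ..
  also have "\<mu> * frob_inner (spectral_mat U r (\<lambda>_. 1)) Z
      = (\<Sum>i<r. \<Sum>j<r'. \<mu> * (z j * (cmod ((mat_adjoint U * U') $$ (i, j)))\<^sup>2))"
    unfolding Z_def frob_inner_spectral_mat[OF U U'] by (simp add: sum_distrib_left)
  also have "\<dots> \<le> (\<Sum>i<r. \<Sum>j<r'. (y i + g i) * (z j * (cmod ((mat_adjoint U * U') $$ (i, j)))\<^sup>2))"
    by (intro sum_mono mult_right_mono) (use yg z in auto)
  also have "\<dots> = frob_inner Y Z + frob_inner G Z"
    unfolding Y_def Z_def G_def frob_inner_spectral_mat[OF U U']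
    by (simp add: algebra_simps sum.distrib)
  finally show ?thesis .
qed

section \<open>Moore-Penrose pseudoinverses and the nonexpansive estimate\<close>

lemma pseudoinverse_unique:
  assumes "is_pseudoinverse A X" "is_pseudoinverse A Y"
  shows "X = Y"
proof -
  obtain n m where A: "A \<in> carrier_mat n m" by auto
  have X: "X \<in> carrier_mat m n" and Y: "Y \<in> carrier_mat m n"
    using assms A unfolding is_pseudoinverse_def by auto
  note pX = assms(1)[unfolded is_pseudoinverse_def] and pY = assms(2)[unfolded is_pseudoinverse_def]
  have AX: "A * X \<in> carrier_mat n n" and AY: "A * Y \<in> carrier_mat n n"
    and XA: "X * A \<in> carrier_mat m m" and YA: "Y * A \<in> carrier_mat m m" using A X Y by auto
  note dims = carrier_matD[OF A] carrier_matD[OF X] carrier_matD[OF Y]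
  \<comment> \<open>\<open>A * X\<close> and \<open>A * Y\<close> are orthogonal projectors onto the
    same range, so each absorbs the other. Taking adjoints reverses the order of the product and
    forces equality; the same works for \<open>X * A\<close> and \<open>Y * A\<close>.\<close>
  have "A * X = A * Y * A * X" using pY by simp
  also have "\<dots> = A * Y * (A * X)" by (simp add: mult_assoc_dim dims)
  finally have "A * X = A * Y * (A * X)" .
  then have "mat_adjoint (A * X) = mat_adjoint (A * X) * mat_adjoint (A * Y)"
    using mat_adjoint_mult[OF AY AX] by simp
  then have "A * X = A * X * (A * Y)" using pX pY by simp
  also have "\<dots> = A * X * A * Y" by (simp add: mult_assoc_dim dims)
  also have "\<dots> = A * Y" using pX by simp
  finally have 1: "A * X = A * Y" .
  have "X * A = X * (A * Y * A)" using pY by simp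
  also have "\<dots> = X * A * (Y * A)" by (simp add: mult_assoc_dim dims)
  finally have "X * A = X * A * (Y * A)" .
  then have "mat_adjoint (X * A) = mat_adjoint (Y * A) * mat_adjoint (X * A)"
    using mat_adjoint_mult[OF XA YA] by simp
  then have "X * A = Y * A * (X * A)" using pX pY by simp
  also have "\<dots> = Y * (A * X * A)" by (simp add: mult_assoc_dim dims)
  also have "\<dots> = Y * A" using pX by simp
  finally have 2: "X * A = Y * A" .
  have "X = X * (A * X)" using pX A X assoc_mult_mat[OF X A X] by simp
  also have "\<dots> = X * A * Y" unfolding 1 using assoc_mult_mat[OF X A Y] by simp
  also have "\<dots> = Y" unfolding 2 using pY by simp
  finally show ?thesis .
qed

lemma pseudoinverse_eqI: "is_pseudoinverse A X \<Longrightarrow> pseudoinverse A = X"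
  unfolding pseudoinverse_def using pseudoinverse_unique by blast

text \<open>The levels \<open>inverse (d i)\<close> of the waterfilling formula are the coefficients
  of a matrix determined by \<open>A\<close> alone, and \<open>U * mat_adjoint U\<close> is likewise
  its range projector. The choice of \<open>U\<close> and \<open>d\<close> thereby drops out of
  later statements.\<close>

lemma reduced_eigendecomp_pseudoinverse:
  assumes "reduced_eigendecomp A r U d"
  shows "is_pseudoinverse A (spectral_mat U r (\<lambda>i. inverse (d i)))"
    and "A * spectral_mat U r (\<lambda>i. inverse (d i)) = U * mat_adjoint U"
proof -
  define n where "n = dim_row A"
  have U: "U \<in> carrier_mat n r" and UU: "mat_adjoint U * U = 1\<^sub>m r" and d: "\<And>i. i < r \<Longrightarrow> 0 < d i"
    and A: "A = spectral_mat U r d"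
    using assms unfolding reduced_eigendecomp_def n_def spectral_mat_def by auto
  \<comment> \<open>Positivity of \<open>d i\<close> is known only for \<open>i < r\<close>, so
    \<open>d i * inverse (d i)\<close> cannot be rewritten to 1 as a function; the diagonal matrices
    have to be compared on their actual entries.\<close>
  have cong: "spectral_mat U r e = spectral_mat U r f" if "\<And>i. i < r \<Longrightarrow> e i = f i" for e f
  proof -
    have "mat_diag r (\<lambda>i. complex_of_real (e i)) = mat_diag r (\<lambda>i. complex_of_real (f i))"
      by (rule eq_matI) (use that in \<open>auto simp: mat_diag_def\<close>)
    then show ?thesis unfolding spectral_mat_def by simp
  qed
  let ?G = "spectral_mat U r (\<lambda>i. inverse (d i))" and ?P = "spectral_mat U r (\<lambda>_. 1)"
  have AG: "A * ?G = ?P" "?G * A = ?P"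
    unfolding A spectral_mat_mult[OF U UU] by (rule cong, use d in force)+
  then show "A * ?G = U * mat_adjoint U" using spectral_mat_one[OF U] by simp
  have "?P * A = A" "?P * ?G = ?G" unfolding A spectral_mat_mult[OF U UU] by simp_all
  then show "is_pseudoinverse A ?G"
    unfolding is_pseudoinverse_def AG spectral_mat_adjoint[OF U]
    using U A carrier_matD[OF spectral_mat_carrier[OF U, of d]] by simp
qed

text \<open>Both sides of \<open>A * G = B * K\<close> are range projectors, so the equation says
  that \<open>Y\<close> and \<open>Z\<close> are projections onto one and the same convex set. The
  decompositions themselves may be unrelated.\<close>

lemma is_waterfilling_lipschitz:
  assumes Y: "is_waterfilling A r p Y" and Z: "is_waterfilling B s p Z"
    and G: "is_pseudoinverse A G" and K: "is_pseudoinverse B K" and range: "A * G = B * K"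
  shows "frobenius_norm (Y - Z) \<le> frobenius_norm (G - K)"
proof -
  obtain U d \<mu> where e1: "reduced_eigendecomp A r U d"
    and t1: "mat_trace (waterfill_diag r d \<mu>) = complex_of_real p"
    and Y: "Y = U * waterfill_diag r d \<mu> * mat_adjoint U" using Y unfolding is_waterfilling_def by blast
  obtain V f \<nu> where e2: "reduced_eigendecomp B s V f"
    and t2: "mat_trace (waterfill_diag s f \<nu>) = complex_of_real p"
    and Z: "Z = V * waterfill_diag s f \<nu> * mat_adjoint V" using Z unfolding is_waterfilling_def by blast
  define n where "n = dim_row A"
  have U: "U \<in> carrier_mat n r" and UU: "mat_adjoint U * U = 1\<^sub>m r"
    using e1 unfolding reduced_eigendecomp_def n_def by auto
  have "dim_row B = n"
    using arg_cong[OF range, of dim_row] unfolding n_def by simp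
  then have V: "V \<in> carrier_mat n s" and VV: "mat_adjoint V * V = 1\<^sub>m s"
    using e2 unfolding reduced_eigendecomp_def by auto
  let ?y = "\<lambda>i. max 0 (\<mu> - inverse (d i))" and ?z = "\<lambda>i. max 0 (\<nu> - inverse (f i))"
  have Gs: "G = spectral_mat U r (\<lambda>i. inverse (d i))"
    by (rule pseudoinverse_unique[OF G reduced_eigendecomp_pseudoinverse(1)[OF e1]])
  have Ks: "K = spectral_mat V s (\<lambda>i. inverse (f i))"
    by (rule pseudoinverse_unique[OF K reduced_eigendecomp_pseudoinverse(1)[OF e2]])
  have UV: "U * mat_adjoint U = V * mat_adjoint V"
    using range reduced_eigendecomp_pseudoinverse(2)[OF e1] reduced_eigendecomp_pseudoinverse(2)[OF e2]
    unfolding Gs Ks by simp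
  have Ys: "Y = spectral_mat U r ?y" and Zs: "Z = spectral_mat V s ?z"
    unfolding Y Z spectral_mat_def waterfill_diag_def by auto
  have sy: "(\<Sum>i<r. ?y i) = p" and sz: "(\<Sum>i<s. ?z i) = p"
    using t1 t2 unfolding waterfill_diag_def mat_trace_diag of_real_eq_iff by auto
  have car: "Y \<in> carrier_mat n n" "Z \<in> carrier_mat n n" "G \<in> carrier_mat n n" "K \<in> carrier_mat n n"
    using U V unfolding Ys Zs Gs Ks by auto
  have v1: "frob_inner Y Y + frob_inner G Y \<le> frob_inner Y Z + frob_inner G Z"
    unfolding Ys Zs Gs by (rule waterfill_variational[OF U UU V VV UV _ sy _ sz]) auto
  have v2: "frob_inner Z Z + frob_inner K Z \<le> frob_inner Z Y + frob_inner K Y"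
    unfolding Ys Zs Ks by (rule waterfill_variational[OF V VV U UU UV[symmetric] _ sz _ sy]) auto
  have D: "Y - Z \<in> carrier_mat n n" "Z - Y \<in> carrier_mat n n" "G - K \<in> carrier_mat n n" using car by auto
  have "(frobenius_norm (Y - Z))\<^sup>2 = frob_inner Y (Y - Z) - frob_inner Z (Y - Z)"
    unfolding frobenius_norm_square[OF D(1)] using frob_inner_diff_left car D by blast
  also have "\<dots> = frob_inner Y Y - frob_inner Z Y - frob_inner Y Z + frob_inner Z Z"
    unfolding frob_inner_commute[OF car(1) D(1)] frob_inner_commute[OF car(2) D(1)]
      frob_inner_diff_left[OF car(1,2,1)] frob_inner_diff_left[OF car(1,2,2)]
    by simp
  also have "\<dots> \<le> frob_inner G Z - frob_inner G Y - frob_inner K Z + frob_inner K Y"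
    using v1 v2 frob_inner_commute[OF car(1,2)] by simp
  also have "\<dots> = frob_inner (Z - Y) (G - K)"
    unfolding frob_inner_diff_left[OF car(2,1) D(3)]
      frob_inner_commute[OF car(1) D(3)] frob_inner_commute[OF car(2) D(3)]
      frob_inner_diff_left[OF car(3,4,1)] frob_inner_diff_left[OF car(3,4,2)]
    by simp
  also have "\<dots> \<le> frobenius_norm (Z - Y) * frobenius_norm (G - K)"
    by (rule frob_inner_le[OF D(2,3)])
  also have "frobenius_norm (Z - Y) = frobenius_norm (Y - Z)"
    unfolding frobenius_norm_def using car by (auto simp: norm_minus_commute intro!: sum.cong)
  finally have "frobenius_norm (Y - Z) * frobenius_norm (Y - Z)
      \<le> frobenius_norm (Y - Z) * frobenius_norm (G - K)" by (simp add: power2_eq_square)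
  then show ?thesis
    using frobenius_norm_nonneg[of "Y - Z"] frobenius_norm_nonneg[of "G - K"]
    by (cases "frobenius_norm (Y - Z) = 0") (auto simp: mult_le_cancel_left)
qed

section \<open>Full row rank, inverses and pseudoinverses\<close>

text \<open>A vector in the kernel of the adjoint is orthogonal to every column. Full row rank means
  that the columns span the space, so the vector is orthogonal to itself.\<close>

lemma full_row_rank_adjoint_inj:
  assumes H: "H \<in> carrier_mat n m" and rank: "mat_rank H = n"
    and v: "v \<in> carrier_vec n" and zero: "mat_adjoint H *\<^sub>v v = 0\<^sub>v m"
  shows "v = 0\<^sub>v n"
proof (rule ccontr)
  assume "v \<noteq> 0\<^sub>v n"
  interpret vec_space "TYPE(complex)" n .
  have cols: "set (cols H) \<subseteq> carrier_vec n" using H cols_dim by blast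
  \<comment> \<open>A maximal independent set of columns has as many elements as the rank, here
    \<open>n\<close>, and is therefore a basis of the whole space.\<close>
  obtain S where S: "finite S" "maximal S (\<lambda>T. T \<subseteq> set (cols H) \<and> lin_indpt T)"
    using maximal_exists_superset[of "set (cols H)" "\<lambda>T. T \<subseteq> set (cols H) \<and> lin_indpt T" "{}"]
    by (metis (no_types, lifting) List.finite_set empty_subsetI finite_lin_indpt2 finite.emptyI empty_iff)
  have SH: "S \<subseteq> set (cols H)" and Sli: "lin_indpt S" using S(2) unfolding maximal_def by auto
  have "card S = n" using rank_card_indpt[OF H S(2)] rank H unfolding mat_rank_def by auto
  then have "basis S"
    by (intro dim_li_is_basis) (use S(1) SH Sli cols in \<open>auto simp: dim_is_n\<close>)
  then have "v \<in> span S" using v unfolding basis_def by auto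
  then obtain a T where T: "finite T" "T \<subseteq> S" "v = lincomb a T" unfolding span_def by auto
  have Tc: "T \<subseteq> carrier_vec n" using T(2) SH cols by auto
  have orth: "x \<bullet>c v = 0" if x: "x \<in> T" for x
  proof -
    obtain j where j: "j < m" "x = col H j"
      using x T(2) SH H by (metis (no_types, lifting) carrier_matD(2) cols_length cols_nth in_mono in_set_conv_nth)
    have "(mat_adjoint H *\<^sub>v v) $ j = (\<Sum>l<n. mat_adjoint H $$ (j, l) * v $ l)"
      by (rule mult_mat_vec_index[OF _ v j(1)]) (use H in auto)
    also have "\<dots> = cnj (\<Sum>l<n. x $ l * cnj (v $ l))"
      unfolding cnj_sum by (rule sum.cong) (use j H in auto)
    also have "\<dots> = cnj (x \<bullet>c v)" unfolding cscalar_prod_index[OF v] ..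
    finally show ?thesis using zero j(1) by simp
  qed
  have "v \<bullet>c v = (\<Sum>i<n. (\<Sum>x\<in>T. a x * x $ i) * cnj (v $ i))"
    unfolding cscalar_prod_index[OF v]
    by (rule sum.cong) (use lincomb_index[OF _ Tc, of _ a] T(3) in auto)
  also have "\<dots> = (\<Sum>x\<in>T. a x * (x \<bullet>c v))"
    unfolding cscalar_prod_index[OF v] sum_distrib_left sum_distrib_right
    by (subst sum.swap) (simp add: mult.assoc)
  also have "\<dots> = 0" using orth by simp
  finally show False using cscalar_prod_self_pos[OF v \<open>v \<noteq> 0\<^sub>v n\<close>] by simp
qed

text \<open>Besides supplying an inverse, this shows that the term
  \<open>the (mat_inverse _)\<close> in the definition of \<open>waterfilling_user\<close> denotes
  it.\<close>

lemma injective_mat_inverse: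
  fixes A :: "complex mat"
  assumes A: "A \<in> carrier_mat n n" and inj: "\<And>v. v \<in> carrier_vec n \<Longrightarrow> A *\<^sub>v v = 0\<^sub>v n \<Longrightarrow> v = 0\<^sub>v n"
  obtains B where "mat_inverse A = Some B" "B \<in> carrier_mat n n" "A * B = 1\<^sub>m n" "B * A = 1\<^sub>m n"
proof -
  have "det A \<noteq> 0" using det_0_iff_vec_prod_zero[OF A] inj by blast
  then have "A \<in> Units (ring_mat TYPE(complex) n ())" by (rule det_non_zero_imp_unit[OF A])
  then obtain B where "mat_inverse A = Some B" using mat_inverse(1)[OF A] by fastforce
  then show ?thesis using that mat_inverse(2)[OF A] by blast
qed

lemma inverse_adjoint:
  fixes A B :: "complex mat"
  assumes A: "A \<in> carrier_mat n n" and B: "B \<in> carrier_mat n n"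
    and AB: "A * B = 1\<^sub>m n" and AH: "mat_adjoint A = A"
  shows "mat_adjoint B = B"
proof -
  have BH: "mat_adjoint B \<in> carrier_mat n n" using B by simp
  have "mat_adjoint B * A = 1\<^sub>m n"
    using mat_adjoint_mult[OF A B] AB AH by simp
  then have "mat_adjoint B * (A * B) = B"
    using assoc_mult_mat[OF BH A B] B by simp
  then show ?thesis using right_mult_one_mat[OF BH] AB by simp
qed

text \<open>The quadratic form at \<open>v\<close> is the squared length of
  \<open>mat_adjoint B *\<^sub>v v\<close>. Assuming only \<open>\<le> 0\<close> makes the fact
  usable for kernel vectors and, by contraposition, for positive definiteness.\<close>

lemma gram_adjoint_inj:
  fixes B :: "complex mat"
  assumes B: "B \<in> carrier_mat n m" and v: "v \<in> carrier_vec n"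
    and q: "Re (((B * mat_adjoint B) *\<^sub>v v) \<bullet>c v) \<le> 0"
  shows "mat_adjoint B *\<^sub>v v = 0\<^sub>v m"
proof (rule ccontr)
  assume nz: "mat_adjoint B *\<^sub>v v \<noteq> 0\<^sub>v m"
  have w: "mat_adjoint B *\<^sub>v v \<in> carrier_vec m"
    using mult_mat_vec_carrier[OF mat_adjoint_carrier[OF B] v] .
  have "((B * mat_adjoint B) *\<^sub>v v) \<bullet>c v = (mat_adjoint B *\<^sub>v v) \<bullet>c (mat_adjoint B *\<^sub>v v)"
    unfolding assoc_mult_mat_vec[OF B mat_adjoint_carrier[OF B] v] by (rule mat_adjoint_cscalar[OF B w v])
  then show False using cscalar_prod_self_pos[OF w nz] q by simp
qed

text \<open>Full row rank makes the Gram matrix H H^H invertible, and the witness is H^H (H H^H)^-1.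
  It is a right inverse, and its product with H on the right is Hermitian because the inverse of a
  Hermitian matrix is.\<close>

lemma full_row_rank_right_pseudoinverse:
  assumes H: "H \<in> carrier_mat n m" and rank: "mat_rank H = n"
  obtains X where "X \<in> carrier_mat m n" "is_pseudoinverse H X" "H * X = 1\<^sub>m n"
proof -
  have HH: "mat_adjoint H \<in> carrier_mat m n" using H by simp
  define G where "G = H * mat_adjoint H"
  have G: "G \<in> carrier_mat n n" unfolding G_def using H HH by auto
  have "v = 0\<^sub>v n" if v: "v \<in> carrier_vec n" and z: "G *\<^sub>v v = 0\<^sub>v n" for v
    by (rule full_row_rank_adjoint_inj[OF H rank v gram_adjoint_inj[OF H v]])
      (use v z in \<open>simp add: G_def[symmetric]\<close>)
  then obtain J where J: "J \<in> carrier_mat n n" "G * J = 1\<^sub>m n"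
    using injective_mat_inverse[OF G] by metis
  have "mat_adjoint G = G" unfolding G_def mat_adjoint_mult[OF H HH] by simp
  note JH = inverse_adjoint[OF G J this]
  define X where "X = mat_adjoint H * J"
  have X: "X \<in> carrier_mat m n" unfolding X_def using HH J by auto
  have HX: "H * X = 1\<^sub>m n" unfolding X_def using assoc_mult_mat[OF H HH J(1)] J(2) G_def by simp
  have XH: "mat_adjoint X = J * H" unfolding X_def mat_adjoint_mult[OF HH J(1)] JH by simp
  have "mat_adjoint (X * H) = X * H"
    unfolding mat_adjoint_mult[OF X H] XH unfolding X_def using assoc_mult_mat[OF HH J(1) H] by simp
  moreover have "X * H * X = X" using assoc_mult_mat[OF X H X] HX X by simp
  ultimately have "is_pseudoinverse H X" unfolding is_pseudoinverse_def using HX H X by simp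
  then show ?thesis using that X HX by blast
qed

text \<open>A reverse-order law for pseudoinverses. It holds here because
  \<open>H * X = 1\<^sub>m n\<close> lets \<open>J\<close> and \<open>R\<close> meet and cancel:
  both products collapse to the projector \<open>X * H\<close>, in which \<open>R\<close> no longer
  occurs.\<close>

lemma sandwich_pseudoinverse:
  assumes H: "H \<in> carrier_mat n m" and X: "X \<in> carrier_mat m n"
    and pinv: "is_pseudoinverse H X" and HX: "H * X = 1\<^sub>m n"
    and R: "R \<in> carrier_mat n n" and J: "J \<in> carrier_mat n n" and RJ: "R * J = 1\<^sub>m n" "J * R = 1\<^sub>m n"
  shows "is_pseudoinverse (mat_adjoint H * J * H) (X * R * mat_adjoint X)"
    and "(mat_adjoint H * J * H) * (X * R * mat_adjoint X) = X * H"
proof -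
  define P where "P = X * H"
  note dims = carrier_matD[OF H] carrier_matD[OF X] carrier_matD[OF R] carrier_matD[OF J]
  have HH: "mat_adjoint H \<in> carrier_mat m n" and XH: "mat_adjoint X \<in> carrier_mat n m" using H X by auto
  have PH: "mat_adjoint P = P" using pinv unfolding is_pseudoinverse_def P_def by simp
  have HXH: "mat_adjoint H * mat_adjoint X = P"
    using mat_adjoint_mult[OF X H] PH unfolding P_def by simp
  have XHHH: "mat_adjoint X * mat_adjoint H = 1\<^sub>m n"
    using mat_adjoint_mult[OF H X] HX by simp
  have Pc: "P \<in> carrier_mat m m" unfolding P_def using X H by auto
  have "(mat_adjoint H * J * H) * (X * R * mat_adjoint X)
      = mat_adjoint H * (J * ((H * X) * (R * mat_adjoint X)))"
    by (simp add: mult_assoc_dim dims)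
  also have "\<dots> = mat_adjoint H * ((J * R) * mat_adjoint X)"
    unfolding HX by (simp add: mult_assoc_dim dims)
  also have "\<dots> = P" unfolding RJ left_mult_one_mat[OF XH] HXH ..
  finally have AG: "(mat_adjoint H * J * H) * (X * R * mat_adjoint X) = P" .
  have "(X * R * mat_adjoint X) * (mat_adjoint H * J * H)
      = X * (R * ((mat_adjoint X * mat_adjoint H) * (J * H)))"
    by (simp add: mult_assoc_dim dims)
  also have "\<dots> = X * ((R * J) * H)"
    unfolding XHHH by (simp add: mult_assoc_dim dims)
  also have "\<dots> = P" unfolding RJ left_mult_one_mat[OF H] P_def ..
  finally have GA: "(X * R * mat_adjoint X) * (mat_adjoint H * J * H) = P" .
  have HP: "H * P = H" unfolding P_def using HX assoc_mult_mat[OF H X H] H by simp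
  have PHH: "P * mat_adjoint H = mat_adjoint H"
    using mat_adjoint_mult[OF H Pc] HP PH by simp
  have PX: "P * X = X" unfolding P_def using HX assoc_mult_mat[OF X H X] X by simp
  have "P * (mat_adjoint H * J * H) = (P * mat_adjoint H) * (J * H)"
    using carrier_matD[OF Pc] by (simp add: mult_assoc_dim dims)
  then have 1: "P * (mat_adjoint H * J * H) = mat_adjoint H * J * H"
    unfolding PHH by (simp add: mult_assoc_dim dims)
  have "P * (X * R * mat_adjoint X) = (P * X) * (R * mat_adjoint X)"
    using carrier_matD[OF Pc] by (simp add: mult_assoc_dim dims)
  then have 2: "P * (X * R * mat_adjoint X) = X * R * mat_adjoint X"
    unfolding PX by (simp add: mult_assoc_dim dims)
  show "is_pseudoinverse (mat_adjoint H * J * H) (X * R * mat_adjoint X)"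
    unfolding is_pseudoinverse_def AG GA PH 1 2 by (auto simp: dims)
  show "(mat_adjoint H * J * H) * (X * R * mat_adjoint X) = X * H" using AG P_def by simp
qed

section \<open>Quadratic forms and positive definite matrices\<close>

lemma spectral_mat_quadratic:
  assumes U: "U \<in> carrier_mat n r" and v: "v \<in> carrier_vec n"
  shows "(spectral_mat U r e *\<^sub>v v) \<bullet>c v
    = complex_of_real (\<Sum>i<r. e i * (cmod ((mat_adjoint U *\<^sub>v v) $ i))\<^sup>2)"
proof -
  let ?D = "mat_diag r (\<lambda>i. complex_of_real (e i))"
  have D: "?D \<in> carrier_mat r r" by (rule mat_diag_dim)
  have UH: "mat_adjoint U \<in> carrier_mat r n" using U by simp
  define w where "w = mat_adjoint U *\<^sub>v v"
  have w: "w \<in> carrier_vec r" unfolding w_def using mult_mat_vec_carrier[OF UH v] .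
  have Dw: "?D *\<^sub>v w \<in> carrier_vec r" using mult_mat_vec_carrier[OF D w] .
  have "spectral_mat U r e *\<^sub>v v = U *\<^sub>v (?D *\<^sub>v w)"
    unfolding spectral_mat_def w_def
    using assoc_mult_mat_vec[OF mult_carrier_mat[OF U D] UH v] assoc_mult_mat_vec[OF U D w]
    unfolding w_def by simp
  then have "(spectral_mat U r e *\<^sub>v v) \<bullet>c v = (?D *\<^sub>v w) \<bullet>c w"
    using mat_adjoint_cscalar[OF U Dw v] unfolding w_def by simp
  also have "\<dots> = (\<Sum>i<r. e i * w $ i * cnj (w $ i))"
    unfolding cscalar_prod_index[OF w]
  proof (rule sum.cong)
    fix i assume i: "i \<in> {..<r}"
    have "(?D *\<^sub>v w) $ i = (\<Sum>l<r. ?D $$ (i, l) * w $ l)"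
      using mult_mat_vec_index[OF D w] i by simp
    also have "\<dots> = (\<Sum>l<r. if l = i then complex_of_real (e i) * w $ i else 0)"
      by (rule sum.cong) (use i in \<open>auto simp: mat_diag_def\<close>)
    finally show "(?D *\<^sub>v w) $ i * cnj (w $ i) = e i * w $ i * cnj (w $ i)" using i by simp
  qed simp
  also have "\<dots> = complex_of_real (\<Sum>i<r. e i * (cmod (w $ i))\<^sup>2)"
    by (simp add: complex_norm_square mult.assoc del: of_real_power)
  finally show ?thesis unfolding w_def .
qed

lemma spectral_mat_eigenvector:
  assumes U: "U \<in> carrier_mat n r" and UU: "mat_adjoint U * U = 1\<^sub>m r" and i: "i < r"
  shows "eigenvector (spectral_mat U r e) (col U i) (complex_of_real (e i))"
proof -
  let ?D = "mat_diag r (\<lambda>i. complex_of_real (e i))"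
  have D: "?D \<in> carrier_mat r r" by (rule mat_diag_dim)
  have UH: "mat_adjoint U \<in> carrier_mat r n" using U by simp
  have c: "col U i \<in> carrier_vec n" using U i by auto
  have UD: "U * ?D \<in> carrier_mat n r" using mult_carrier_mat[OF U D] .
  have Uc: "mat_adjoint U *\<^sub>v col U i = unit_vec r i"
    using col_mult2[OF UH U i] UU i by simp
  have "spectral_mat U r e *\<^sub>v col U i = (U * ?D) *\<^sub>v unit_vec r i"
    unfolding spectral_mat_def using assoc_mult_mat_vec[OF UD UH c] Uc by simp
  also have "\<dots> = complex_of_real (e i) \<cdot>\<^sub>v col U i"
  proof (rule eq_vecI)
    fix k assume "k < dim_vec (complex_of_real (e i) \<cdot>\<^sub>v col U i)"
    then have k: "k < n" using U by simp
    have "((U * ?D) *\<^sub>v unit_vec r i) $ k = (\<Sum>l<r. (U * ?D) $$ (k, l) * unit_vec r i $ l)"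
      by (rule mult_mat_vec_index[OF UD _ k]) simp
    also have "\<dots> = (\<Sum>l<r. if l = i then U $$ (k, i) * e i else 0)"
      unfolding mat_diag_mult_right[OF U] by (rule sum.cong) (use i k in auto)
    finally show "((U * ?D) *\<^sub>v unit_vec r i) $ k = (complex_of_real (e i) \<cdot>\<^sub>v col U i) $ k"
      using i k U by (simp add: mult.commute)
  qed (use U in auto)
  finally have ev: "spectral_mat U r e *\<^sub>v col U i = complex_of_real (e i) \<cdot>\<^sub>v col U i" .
  have "col U i \<noteq> 0\<^sub>v n"
  proof
    assume "col U i = 0\<^sub>v n"
    then have "unit_vec r i = mat_adjoint U *\<^sub>v 0\<^sub>v n" using Uc by simp
    also have "\<dots> = 0\<^sub>v r" by (rule eq_vecI) (use U in \<open>auto simp: scalar_prod_def\<close>)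
    finally show False using i by simp
  qed
  then show ?thesis unfolding eigenvector_def
    using ev c carrier_matD[OF spectral_mat_carrier[OF U, of e]] by simp
qed

text \<open>At a column of \<open>V\<close> the form equals the eigenvalue times a positive squared
  length, so every eigenvalue is positive.\<close>

lemma posdef_spectral_mat:
  assumes A: "A \<in> carrier_mat n n" and H: "mat_adjoint A = A"
    and pos: "\<And>v. v \<in> carrier_vec n \<Longrightarrow> v \<noteq> 0\<^sub>v n \<Longrightarrow> 0 < Re ((A *\<^sub>v v) \<bullet>c v)"
  obtains V e where "V \<in> carrier_mat n n" "mat_adjoint V * V = 1\<^sub>m n" "A = spectral_mat V n e"
    "\<And>i. i < n \<Longrightarrow> 0 < e i"
proof -
  obtain V e where V: "V \<in> carrier_mat n n" and VV: "mat_adjoint V * V = 1\<^sub>m n"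
    and AV: "A = spectral_mat V n e"
    using hermitian_unitary_diagonalization[OF A H] unfolding spectral_mat_def by blast
  have "0 < e i" if i: "i < n" for i
  proof -
    have c: "col V i \<in> carrier_vec n" using V i by auto
    have ev: "A *\<^sub>v col V i = complex_of_real (e i) \<cdot>\<^sub>v col V i" and nz: "col V i \<noteq> 0\<^sub>v n"
      using spectral_mat_eigenvector[OF V VV i, of e] A unfolding AV eigenvector_def by auto
    have "(A *\<^sub>v col V i) \<bullet>c col V i = complex_of_real (e i) * (col V i \<bullet>c col V i)"
      unfolding ev using c by simp
    then have "0 < e i * Re (col V i \<bullet>c col V i)" using pos[OF c nz] by simp
    then show ?thesis using cscalar_prod_self_pos[OF c nz] by (simp add: zero_less_mult_iff)
  qed
  then show ?thesis using that V VV AV by blast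
qed

section \<open>Existence of the waterfilling matrix\<close>

text \<open>B^H B may be singular, whereas B B^H is invertible and has the same nonzero spectrum.
  Diagonalizing the latter and carrying its eigenvectors over by B^H, as in a singular value
  decomposition, yields exactly \<open>n\<close> columns with positive eigenvalues.\<close>

lemma gram_reduced_eigendecomp:
  fixes B :: "complex mat"
  assumes B: "B \<in> carrier_mat n m"
    and inj: "\<And>v. v \<in> carrier_vec n \<Longrightarrow> mat_adjoint B *\<^sub>v v = 0\<^sub>v m \<Longrightarrow> v = 0\<^sub>v n"
  shows "\<exists>U d. reduced_eigendecomp (mat_adjoint B * B) n U d"
proof -
  have BH: "mat_adjoint B \<in> carrier_mat m n" using B by simp
  have BB: "B * mat_adjoint B \<in> carrier_mat n n" using mult_carrier_mat[OF B BH] .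
  have "mat_adjoint (B * mat_adjoint B) = B * mat_adjoint B"
    unfolding mat_adjoint_mult[OF B BH] by simp
  moreover have "0 < Re (((B * mat_adjoint B) *\<^sub>v v) \<bullet>c v)"
    if v: "v \<in> carrier_vec n" "v \<noteq> 0\<^sub>v n" for v
    using gram_adjoint_inj[OF B v(1)] inj[OF v(1)] v(2) by (meson not_le_imp_less)
  ultimately obtain V e where V: "V \<in> carrier_mat n n" and VV: "mat_adjoint V * V = 1\<^sub>m n"
    and BV: "B * mat_adjoint B = spectral_mat V n e" and e: "\<And>i. i < n \<Longrightarrow> 0 < e i"
    using posdef_spectral_mat[OF BB] by metis
  let ?E = "mat_diag n (\<lambda>i. complex_of_real (e i))"
  let ?F = "mat_diag n (\<lambda>i. complex_of_real (1 / sqrt (e i)))"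
  have VH: "mat_adjoint V \<in> carrier_mat n n" using V by simp
  have VV': "V * mat_adjoint V = 1\<^sub>m n" by (rule mat_mult_left_right_inverse[OF VH V VV])
  have E: "?E \<in> carrier_mat n n" and F: "?F \<in> carrier_mat n n" by (rule mat_diag_dim)+
  have FEF: "?F * ?E * ?F = 1\<^sub>m n"
  proof -
    have "1 / sqrt (e i) * e i * (1 / sqrt (e i)) = 1" if "i < n" for i
      using e[OF that] by (simp add: field_simps)
    then have "complex_of_real (1 / sqrt (e i)) * complex_of_real (e i) * complex_of_real (1 / sqrt (e i)) = 1"
      if "i < n" for i using that by (metis of_real_1 of_real_mult)
    then show ?thesis unfolding mat_diag_diag by (intro eq_matI) (auto simp: mat_diag_def)
  qed
  have EF: "?F * ?E = ?E * ?F" unfolding mat_diag_diag by (simp add: mult.commute)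
  \<comment> \<open>The columns of \<open>mat_adjoint B * V\<close> are orthogonal with squared
    lengths \<open>e i\<close>; the factor \<open>?F\<close> normalizes them.\<close>
  define U where "U = mat_adjoint B * (V * ?F)"
  have VF: "V * ?F \<in> carrier_mat n n" using mult_carrier_mat[OF V F] .
  have U: "U \<in> carrier_mat m n" unfolding U_def using mult_carrier_mat[OF BH VF] .
  have UH: "mat_adjoint U = ?F * mat_adjoint V * B"
    unfolding U_def mat_adjoint_mult[OF BH VF] mat_adjoint_mult[OF V F]
      mat_adjoint_diag_real mat_adjoint_adjoint ..
  note dims = carrier_matD[OF B] carrier_matD[OF V] carrier_matD[OF E] carrier_matD[OF F]
  have "mat_adjoint U * U = ?F * (mat_adjoint V * ((B * mat_adjoint B) * (V * ?F)))"
    unfolding UH unfolding U_def by (simp add: mult_assoc_dim dims del: mat_diag_diag)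
  also have "\<dots> = ?F * ((mat_adjoint V * V) * (?E * ((mat_adjoint V * V) * ?F)))"
    unfolding BV spectral_mat_def by (simp add: mult_assoc_dim dims del: mat_diag_diag)
  also have "\<dots> = ?F * (?E * ?F)" unfolding VV left_mult_one_mat[OF F]
    left_mult_one_mat[OF mult_carrier_mat[OF E F]] ..
  also have "\<dots> = 1\<^sub>m n" using FEF assoc_mult_mat[OF F E F] by simp
  finally have UU: "mat_adjoint U * U = 1\<^sub>m n" .
  have "U * ?E * mat_adjoint U = mat_adjoint B * (V * ((?F * ?E * ?F) * (mat_adjoint V * B)))"
    unfolding UH unfolding U_def by (simp add: mult_assoc_dim dims del: mat_diag_diag)
  also have "\<dots> = mat_adjoint B * ((V * mat_adjoint V) * B)"
    unfolding FEF left_mult_one_mat[OF mult_carrier_mat[OF VH B]] by (simp add: mult_assoc_dim dims del: mat_diag_diag)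
  also have "\<dots> = mat_adjoint B * B" unfolding VV' left_mult_one_mat[OF B] ..
  finally show ?thesis unfolding reduced_eigendecomp_def using U UU e B by (metis carrier_matD(2) index_mult_mat(2) mat_adjoint_dim(1))
qed

text \<open>Whitening: with L = R^(-1/2) the inverse \<open>J\<close> factors as L L, so the
  sandwich is the Gram matrix B^H B of \<open>B = L * H\<close>. Invertibility of L transfers
  injectivity from the adjoint of \<open>H\<close> to that of \<open>B\<close>.\<close>

lemma sandwich_reduced_eigendecomp:
  fixes H R J :: "complex mat"
  assumes H: "H \<in> carrier_mat n m"
    and inj: "\<And>v. v \<in> carrier_vec n \<Longrightarrow> mat_adjoint H *\<^sub>v v = 0\<^sub>v m \<Longrightarrow> v = 0\<^sub>v n"
    and R: "R \<in> carrier_mat n n" "mat_adjoint R = R"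
    and pos: "\<And>v. v \<in> carrier_vec n \<Longrightarrow> v \<noteq> 0\<^sub>v n \<Longrightarrow> 0 < Re ((R *\<^sub>v v) \<bullet>c v)"
    and J: "J \<in> carrier_mat n n" "R * J = 1\<^sub>m n" "J * R = 1\<^sub>m n"
  shows "\<exists>U d. reduced_eigendecomp (mat_adjoint H * J * H) n U d"
proof -
  obtain V e where V: "V \<in> carrier_mat n n" and VV: "mat_adjoint V * V = 1\<^sub>m n"
    and RV: "R = spectral_mat V n e" and e: "\<And>i. i < n \<Longrightarrow> 0 < e i"
    using posdef_spectral_mat[OF R pos] by metis
  have VH: "mat_adjoint V \<in> carrier_mat n n" using V by simp
  have VV': "V * mat_adjoint V = 1\<^sub>m n" by (rule mat_mult_left_right_inverse[OF VH V VV])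
  let ?L = "spectral_mat V n (\<lambda>i. 1 / sqrt (e i))"
  have L: "?L \<in> carrier_mat n n" using V by simp
  have LH: "mat_adjoint ?L = ?L" by (rule spectral_mat_adjoint[OF V])
  have "R * (?L * ?L) = 1\<^sub>m n"
  proof -
    have "mat_diag n (\<lambda>i. complex_of_real (e i * (1 / sqrt (e i) * (1 / sqrt (e i))))) = 1\<^sub>m n"
      by (rule eq_matI) (use e in \<open>force simp: mat_diag_def less_imp_le abs_of_pos simp del: of_real_mult of_real_divide\<close>)+
    then show ?thesis
      unfolding RV spectral_mat_mult[OF V VV] unfolding spectral_mat_def using VV' V by simp
  qed
  then have "J * (R * (?L * ?L)) = J" using J(1) by simp
  then have JL: "J = ?L * ?L"
    using assoc_mult_mat[OF J(1) R(1) mult_carrier_mat[OF L L]] J(3)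
      left_mult_one_mat[OF mult_carrier_mat[OF L L]] by simp
  have HH: "mat_adjoint H \<in> carrier_mat m n" using H by simp
  define B where "B = ?L * H"
  have B: "B \<in> carrier_mat n m" unfolding B_def using mult_carrier_mat[OF L H] .
  have BH: "mat_adjoint B = mat_adjoint H * ?L" unfolding B_def mat_adjoint_mult[OF L H] LH ..
  have "v = 0\<^sub>v n" if v: "v \<in> carrier_vec n" and z: "mat_adjoint B *\<^sub>v v = 0\<^sub>v m" for v
  proof -
    have Lv: "?L *\<^sub>v v \<in> carrier_vec n" using mult_mat_vec_carrier[OF L v] .
    have "mat_adjoint H *\<^sub>v (?L *\<^sub>v v) = 0\<^sub>v m"
      using z unfolding BH assoc_mult_mat_vec[OF HH L v] .
    then have "?L *\<^sub>v v = 0\<^sub>v n" by (rule inj[OF Lv])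
    have RLL: "(R * ?L) * ?L = 1\<^sub>m n"
      using \<open>R * (?L * ?L) = 1\<^sub>m n\<close> assoc_mult_mat[OF R(1) L L] by simp
    have "v = ((R * ?L) * ?L) *\<^sub>v v" unfolding RLL using v by simp
    also have "\<dots> = (R * ?L) *\<^sub>v 0\<^sub>v n"
      using assoc_mult_mat_vec[OF mult_carrier_mat[OF R(1) L] L v] \<open>?L *\<^sub>v v = 0\<^sub>v n\<close> by simp
    also have "\<dots> = 0\<^sub>v n" by (rule eq_vecI) (use R(1) in \<open>auto simp: scalar_prod_def\<close>)
    finally show ?thesis .
  qed
  from gram_reduced_eigendecomp[OF B this]
  have "\<exists>U d. reduced_eigendecomp (mat_adjoint B * B) n U d" .
  also have "mat_adjoint B * B = mat_adjoint H * J * H"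
    unfolding BH unfolding B_def JL
    using carrier_matD[OF H] carrier_matD[OF L] by (simp add: mult_assoc_dim)
  finally show ?thesis .
qed

lemma water_level_exists:
  fixes d :: "nat \<Rightarrow> real"
  assumes r: "0 < r" and d: "\<And>i. i < r \<Longrightarrow> 0 < d i" and p: "0 < p"
  shows "\<exists>\<mu>. (\<Sum>i<r. max 0 (\<mu> - inverse (d i))) = p"
proof -
  let ?f = "\<lambda>\<mu>. \<Sum>i<r. max 0 (\<mu> - inverse (d i))"
  have "max 0 (0 - inverse (d i)) = 0" if "i < r" for i using d[OF that] by (simp add: max_def)
  then have "?f 0 = 0" by (intro sum.neutral) simp
  then have 0: "?f 0 \<le> p" using p by simp
  \<comment> \<open>Upper end for the intermediate value theorem: at the level
    \<open>p + inverse (d 0)\<close> channel 0 alone already takes the whole budget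
    \<open>p\<close>.\<close>
  have "p \<le> max 0 ((p + inverse (d 0)) - inverse (d 0))" by simp
  also have "\<dots> \<le> ?f (p + inverse (d 0))"
    by (rule member_le_sum[where f = "\<lambda>i. max 0 (p + inverse (d 0) - inverse (d i))"]) (use r in auto)
  finally have 1: "p \<le> ?f (p + inverse (d 0))" .
  have "0 \<le> p + inverse (d 0)" using p d[OF r] by (simp add: less_imp_le)
  moreover have "continuous_on {0..p + inverse (d 0)} ?f" by (intro continuous_intros)
  ultimately show ?thesis using IVT'[where f = ?f, OF 0 1] by blast
qed

lemma is_waterfilling_exists:
  assumes e: "reduced_eigendecomp A r U d" and r: "0 < r" and p: "0 < p"
  shows "\<exists>X. is_waterfilling A r p X"
proof -
  have d: "0 < d i" if "i < r" for i using e that unfolding reduced_eigendecomp_def by blast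
  obtain \<mu> where \<mu>: "(\<Sum>i<r. max 0 (\<mu> - inverse (d i))) = p"
    using water_level_exists[of r d p] r d p by blast
  have "mat_trace (waterfill_diag r d \<mu>) = complex_of_real p"
    unfolding waterfill_diag_def mat_trace_diag \<mu> ..
  then show ?thesis unfolding is_waterfilling_def using e by blast
qed

lemma is_waterfilling_carrier:
  assumes A: "A \<in> carrier_mat n n" and X: "is_waterfilling A r p X"
  shows "X \<in> carrier_mat n n" "psd_mat X" "mat_trace X = complex_of_real p"
proof -
  obtain U d \<mu> where U: "U \<in> carrier_mat n r" "mat_adjoint U * U = 1\<^sub>m r"
    and t: "mat_trace (waterfill_diag r d \<mu>) = complex_of_real p"
    and X: "X = spectral_mat U r (\<lambda>i. max 0 (\<mu> - inverse (d i)))"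
    using X A unfolding is_waterfilling_def reduced_eigendecomp_def waterfill_diag_def spectral_mat_def
    by auto
  show Xc: "X \<in> carrier_mat n n" unfolding X using U(1) by simp
  show "mat_trace X = complex_of_real p"
    unfolding X mat_trace_spectral_mat[OF U] t[symmetric] waterfill_diag_def mat_trace_diag ..
  have "0 \<le> Re ((X *\<^sub>v v) \<bullet>c v)" if "v \<in> carrier_vec n" for v
    unfolding X spectral_mat_quadratic[OF U(1) that] by (auto intro!: sum_nonneg)
  then show "psd_mat X"
    unfolding psd_mat_def hermitian_mat_def using Xc spectral_mat_adjoint[OF U(1)] X by auto
qed

text \<open>Two solutions for one \<open>A\<close> share the pseudoinverse, so the Lipschitz bound
  is 0. With existence this gives the \<open>THE\<close> in \<open>waterfilling_user\<close> its
  meaning.\<close>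

lemma is_waterfilling_unique:
  assumes X: "is_waterfilling A r p X" and Y: "is_waterfilling A r p Y"
  shows "X = Y"
proof -
  obtain U d where e: "reduced_eigendecomp A r U d" using X unfolding is_waterfilling_def by blast
  note G = reduced_eigendecomp_pseudoinverse(1)[OF e]
  define n where "n = dim_row A"
  have "dim_col A = n"
    using e unfolding reduced_eigendecomp_def n_def
    by (metis carrier_matD(1) index_mult_mat(3) mat_adjoint_dim(2))
  then have A: "A \<in> carrier_mat n n" unfolding n_def by blast
  note Xc = is_waterfilling_carrier(1)[OF A X] and Yc = is_waterfilling_carrier(1)[OF A Y]
  let ?G = "spectral_mat U r (\<lambda>i. inverse (d i))"
  have "frobenius_norm (?G - ?G) = 0"
    unfolding frobenius_norm_def by simp
  then have "frobenius_norm (X - Y) \<le> 0" using is_waterfilling_lipschitz[OF X Y G G refl] by simp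
  then have "X - Y = 0\<^sub>m n n" by (rule frobenius_norm_eq_0D[rotated]) (use Xc Yc in auto)
  then have "(X - Y) $$ (i, j) = 0" if "i < n" "j < n" for i j using that by simp
  then show ?thesis using Xc Yc by (intro eq_matI) auto
qed

section \<open>Frobenius norm and spectral radius\<close>

lemma frobenius_norm_square_cols:
  assumes A: "A \<in> carrier_mat n m"
  shows "(frobenius_norm A)\<^sup>2 = (\<Sum>j<m. Re (col A j \<bullet>c col A j))"
proof -
  have "(frobenius_norm A)\<^sup>2 = (\<Sum>i<n. \<Sum>j<m. (cmod (A $$ (i, j)))\<^sup>2)"
    using A unfolding frobenius_norm_def by (simp add: sum_nonneg)
  also have "\<dots> = (\<Sum>j<m. \<Sum>i<n. (cmod (A $$ (i, j)))\<^sup>2)" by (rule sum.swap)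
  also have "\<dots> = (\<Sum>j<m. Re (col A j \<bullet>c col A j))"
  proof (intro sum.cong refl)
    fix j assume "j \<in> {..<m}"
    then have c: "col A j \<in> carrier_vec n" and "j < m" using A by auto
    then show "(\<Sum>i<n. (cmod (A $$ (i, j)))\<^sup>2) = Re (col A j \<bullet>c col A j)"
      unfolding cscalar_prod_self[OF c] using A by simp
  qed
  finally show ?thesis .
qed

text \<open>Rayleigh quotient bound: in an orthonormal eigenbasis the form is a sum of eigenvalues
  with nonnegative weights. The condition \<open>0 < n\<close> keeps the spectrum nonempty, so that
  the maximum defining \<open>spectral_radius\<close> is attained.\<close>

lemma spectral_radius_quadratic:
  assumes K: "K \<in> carrier_mat m n" and n: "0 < n" and v: "v \<in> carrier_vec n"
  shows "Re ((K *\<^sub>v v) \<bullet>c (K *\<^sub>v v)) \<le> spectral_radius (mat_adjoint K * K) * Re (v \<bullet>c v)"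
proof -
  let ?A = "mat_adjoint K * K" let ?\<rho> = "spectral_radius ?A"
  have KH: "mat_adjoint K \<in> carrier_mat n m" using K by simp
  have A: "?A \<in> carrier_mat n n" using mult_carrier_mat[OF KH K] .
  have "mat_adjoint ?A = ?A" unfolding mat_adjoint_mult[OF KH K] by simp
  then obtain V e where V: "V \<in> carrier_mat n n" and VV: "mat_adjoint V * V = 1\<^sub>m n"
    and AV: "?A = spectral_mat V n e"
    using hermitian_unitary_diagonalization[OF A] unfolding spectral_mat_def by blast
  have VH: "mat_adjoint V \<in> carrier_mat n n" using V by simp
  have VV': "V * mat_adjoint V = 1\<^sub>m n" by (rule mat_mult_left_right_inverse[OF VH V VV])
  have e: "e i \<le> ?\<rho>" if "i < n" for i
  proof -
    have "complex_of_real (e i) \<in> spectrum ?A"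
      unfolding spectrum_def eigenvalue_def AV using spectral_mat_eigenvector[OF V VV that] by blast
    then have "\<bar>e i\<bar> \<le> ?\<rho>" by (intro spectral_radius_mem_max(2)[OF A n]) force
    then show ?thesis by simp
  qed
  let ?w = "mat_adjoint V *\<^sub>v v"
  have Kv: "K *\<^sub>v v \<in> carrier_vec m" using mult_mat_vec_carrier[OF K v] .
  have "(?A *\<^sub>v v) \<bullet>c v = (K *\<^sub>v v) \<bullet>c (K *\<^sub>v v)"
    unfolding assoc_mult_mat_vec[OF KH K v] using mat_adjoint_cscalar[OF KH Kv v] by simp
  then have "Re ((K *\<^sub>v v) \<bullet>c (K *\<^sub>v v)) = (\<Sum>i<n. e i * (cmod (?w $ i))\<^sup>2)"
    unfolding AV spectral_mat_quadratic[OF V v] by (metis Re_complex_of_real)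
  also have "\<dots> \<le> (\<Sum>i<n. ?\<rho> * (cmod (?w $ i))\<^sup>2)"
    by (intro sum_mono mult_right_mono) (use e in auto)
  also have "\<dots> = ?\<rho> * Re ((spectral_mat V n (\<lambda>_. 1) *\<^sub>v v) \<bullet>c v)"
    unfolding spectral_mat_quadratic[OF V v] by (simp add: sum_distrib_left)
  also have "spectral_mat V n (\<lambda>_. 1) *\<^sub>v v = v"
    unfolding spectral_mat_one[OF V] VV' using v by simp
  finally show ?thesis .
qed

lemma spectral_radius_nonneg:
  assumes "A \<in> carrier_mat n n" "0 < n"
  shows "0 \<le> spectral_radius A"
  using spectral_radius_mem_max(1)[OF assms] by auto

lemma frobenius_norm_mult_spectral_radius:
  assumes K: "K \<in> carrier_mat m n" and n: "0 < n" and X: "X \<in> carrier_mat n k"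
  shows "(frobenius_norm (K * X))\<^sup>2 \<le> spectral_radius (mat_adjoint K * K) * (frobenius_norm X)\<^sup>2"
proof -
  have "(frobenius_norm (K * X))\<^sup>2 = (\<Sum>j<k. Re ((K *\<^sub>v col X j) \<bullet>c (K *\<^sub>v col X j)))"
    unfolding frobenius_norm_square_cols[OF mult_carrier_mat[OF K X]]
    by (intro sum.cong refl) (use col_mult2[OF K X] in auto)
  also have "\<dots> \<le> (\<Sum>j<k. spectral_radius (mat_adjoint K * K) * Re (col X j \<bullet>c col X j))"
    by (intro sum_mono spectral_radius_quadratic[OF K n]) (use X in auto)
  finally show ?thesis unfolding frobenius_norm_square_cols[OF X] sum_distrib_left .
qed

text \<open>Each outer factor costs the square root of the spectral radius. The right one is turned
  into a left one by taking adjoints, which preserve the norm, so \<open>X\<close> may be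
  arbitrary.\<close>

lemma frobenius_norm_congruence:
  assumes K: "K \<in> carrier_mat m n" and n: "0 < n" and X: "X \<in> carrier_mat n n"
  shows "frobenius_norm (K * X * mat_adjoint K) \<le> spectral_radius (mat_adjoint K * K) * frobenius_norm X"
proof -
  let ?\<rho> = "spectral_radius (mat_adjoint K * K)"
  have KH: "mat_adjoint K \<in> carrier_mat n m" using K by simp
  have \<rho>: "0 \<le> ?\<rho>" by (rule spectral_radius_nonneg[OF mult_carrier_mat[OF KH K] n])
  have XK: "X * mat_adjoint K \<in> carrier_mat n m" using mult_carrier_mat[OF X KH] .
  have "(frobenius_norm (K * X * mat_adjoint K))\<^sup>2 \<le> ?\<rho> * (frobenius_norm (X * mat_adjoint K))\<^sup>2"
    unfolding assoc_mult_mat[OF K X KH] by (rule frobenius_norm_mult_spectral_radius[OF K n XK])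
  also have "frobenius_norm (X * mat_adjoint K) = frobenius_norm (K * mat_adjoint X)"
    using mat_adjoint_mult[OF X KH] frobenius_norm_adjoint[of "X * mat_adjoint K"] by simp
  also have "?\<rho> * (frobenius_norm (K * mat_adjoint X))\<^sup>2 \<le> ?\<rho> * (?\<rho> * (frobenius_norm X)\<^sup>2)"
    using frobenius_norm_mult_spectral_radius[OF K n mat_adjoint_carrier[OF X]] \<rho>
    by (intro mult_left_mono) auto
  finally have "(frobenius_norm (K * X * mat_adjoint K))\<^sup>2 \<le> (?\<rho> * frobenius_norm X)\<^sup>2"
    by (simp add: power_mult_distrib power2_eq_square mult_ac)
  then show ?thesis by (rule power2_le_imp_le) (use \<rho> in simp)
qed

section \<open>The multiuser waterfilling mapping\<close>

lemma quadratic_form_index: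
  fixes A :: "complex mat"
  assumes A: "A \<in> carrier_mat n n" and v: "v \<in> carrier_vec n"
  shows "(A *\<^sub>v v) \<bullet>c v = (\<Sum>i<n. \<Sum>l<n. A $$ (i, l) * v $ l * cnj (v $ i))"
  unfolding cscalar_prod_index[OF v] using mult_mat_vec_index[OF A v]
  by (auto simp: sum_distrib_right intro!: sum.cong)

lemma psd_congruence:
  assumes H: "H \<in> carrier_mat n k" and X: "X \<in> carrier_mat k k" "psd_mat X"
  shows "mat_adjoint (H * X * mat_adjoint H) = H * X * mat_adjoint H"
    and "v \<in> carrier_vec n \<Longrightarrow> 0 \<le> Re (((H * X * mat_adjoint H) *\<^sub>v v) \<bullet>c v)"
proof -
  have HH: "mat_adjoint H \<in> carrier_mat k n" using H by simp
  have XH: "mat_adjoint X = X" using X(2) unfolding psd_mat_def hermitian_mat_def by simp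
  show "mat_adjoint (H * X * mat_adjoint H) = H * X * mat_adjoint H"
    unfolding mat_adjoint_mult[OF mult_carrier_mat[OF H X(1)] HH] mat_adjoint_mult[OF H X(1)] XH
    using assoc_mult_mat[OF H X(1) HH] by simp
  assume v: "v \<in> carrier_vec n"
  define w where "w = mat_adjoint H *\<^sub>v v"
  have w: "w \<in> carrier_vec k" unfolding w_def using mult_mat_vec_carrier[OF HH v] .
  have Xw: "X *\<^sub>v w \<in> carrier_vec k" using mult_mat_vec_carrier[OF X(1) w] .
  have "(H * X * mat_adjoint H) *\<^sub>v v = H *\<^sub>v (X *\<^sub>v w)"
    unfolding assoc_mult_mat_vec[OF mult_carrier_mat[OF H X(1)] HH v]
    using assoc_mult_mat_vec[OF H X(1) w] unfolding w_def by simp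
  then have "((H * X * mat_adjoint H) *\<^sub>v v) \<bullet>c v = (X *\<^sub>v w) \<bullet>c w"
    using mat_adjoint_cscalar[OF H Xw v] unfolding w_def by simp
  then show "0 \<le> Re (((H * X * mat_adjoint H) *\<^sub>v v) \<bullet>c v)"
    using X w unfolding psd_mat_def by simp
qed

text \<open>Quadratic forms are additive in the matrix, so strict positivity of the noise term
  survives adding interference. The computation runs over entries because the covariance is defined
  entrywise.\<close>

lemma posdef_plus_entrywise_sum:
  assumes N: "N \<in> carrier_mat n n" "posdef_mat N"
    and M: "\<And>r. r \<in> I \<Longrightarrow> M r \<in> carrier_mat n n" "\<And>r. r \<in> I \<Longrightarrow> mat_adjoint (M r) = M r"
      "\<And>r v. r \<in> I \<Longrightarrow> v \<in> carrier_vec n \<Longrightarrow> 0 \<le> Re ((M r *\<^sub>v v) \<bullet>c v)"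
  defines "R \<equiv> mat n n (\<lambda>p. N $$ p + (\<Sum>r\<in>I. M r $$ p))"
  shows "mat_adjoint R = R"
    and "v \<in> carrier_vec n \<Longrightarrow> v \<noteq> 0\<^sub>v n \<Longrightarrow> 0 < Re ((R *\<^sub>v v) \<bullet>c v)"
proof -
  have R: "R \<in> carrier_mat n n" unfolding R_def by simp
  show "mat_adjoint R = R"
  proof (rule eq_matI)
    fix i j assume "i < dim_row R" "j < dim_col R"
    then have ij: "i < n" "j < n" using R by auto
    have "cnj (N $$ (j, i)) = N $$ (i, j)"
      using N ij mat_adjoint_index[of i N j] unfolding posdef_mat_def hermitian_mat_def by simp
    moreover have "cnj (M r $$ (j, i)) = M r $$ (i, j)" if "r \<in> I" for r
      using M(1,2)[OF that] ij mat_adjoint_index[of i "M r" j] by simp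
    ultimately show "mat_adjoint R $$ (i, j) = R $$ (i, j)" using ij unfolding R_def by simp
  qed (use R in auto)
  assume v: "v \<in> carrier_vec n" "v \<noteq> 0\<^sub>v n"
  have "(R *\<^sub>v v) \<bullet>c v = (\<Sum>i<n. \<Sum>l<n. N $$ (i, l) * v $ l * cnj (v $ i)
      + (\<Sum>r\<in>I. M r $$ (i, l) * v $ l * cnj (v $ i)))"
    unfolding quadratic_form_index[OF R v(1)]
    by (intro sum.cong refl) (simp add: R_def sum_distrib_right ring_distribs)
  also have "\<dots> = (N *\<^sub>v v) \<bullet>c v + (\<Sum>i<n. \<Sum>l<n. \<Sum>r\<in>I. M r $$ (i, l) * v $ l * cnj (v $ i))"
    unfolding quadratic_form_index[OF N(1) v(1)] sum.distrib ..
  also have "(\<Sum>i<n. \<Sum>l<n. \<Sum>r\<in>I. M r $$ (i, l) * v $ l * cnj (v $ i))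
      = (\<Sum>i<n. \<Sum>r\<in>I. \<Sum>l<n. M r $$ (i, l) * v $ l * cnj (v $ i))"
    by (rule sum.cong[OF refl], rule sum.swap)
  also have "\<dots> = (\<Sum>r\<in>I. \<Sum>i<n. \<Sum>l<n. M r $$ (i, l) * v $ l * cnj (v $ i))" by (rule sum.swap)
  also have "\<dots> = (\<Sum>r\<in>I. (M r *\<^sub>v v) \<bullet>c v)"
    by (intro sum.cong refl) (use quadratic_form_index[OF M(1) v(1)] in simp)
  finally have eq: "Re ((R *\<^sub>v v) \<bullet>c v) = Re ((N *\<^sub>v v) \<bullet>c v) + (\<Sum>r\<in>I. Re ((M r *\<^sub>v v) \<bullet>c v))"
    by simp
  have "0 < Re ((N *\<^sub>v v) \<bullet>c v)" using N v unfolding posdef_mat_def by auto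
  moreover have "0 \<le> (\<Sum>r\<in>I. Re ((M r *\<^sub>v v) \<bullet>c v))" using M(3) v(1) by (intro sum_nonneg) auto
  ultimately show "0 < Re ((R *\<^sub>v v) \<bullet>c v)" unfolding eq by simp
qed

lemma congruence_entrywise_sum:
  assumes K: "K \<in> carrier_mat m n" and "finite I" "\<And>r. r \<in> I \<Longrightarrow> M r \<in> carrier_mat n n"
  shows "K * mat n n (\<lambda>p. \<Sum>r\<in>I. M r $$ p) * mat_adjoint K
    = mat m m (\<lambda>p. \<Sum>r\<in>I. (K * M r * mat_adjoint K) $$ p)"
  using assms(2,3)
proof (induction I)
  case empty
  have "mat n n (\<lambda>p. \<Sum>r\<in>{}. M r $$ p) = 0\<^sub>m n n" by (rule eq_matI) auto
  moreover have "mat m m (\<lambda>p. \<Sum>r\<in>{}. (K * M r * mat_adjoint K) $$ p) = 0\<^sub>m m m" by (rule eq_matI) auto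
  ultimately show ?case
    using right_mult_zero_mat[OF K] left_mult_zero_mat[OF mat_adjoint_carrier[OF K]] by metis
next
  case (insert s I)
  let ?S = "mat n n (\<lambda>p. \<Sum>r\<in>I. M r $$ p)"
  have S: "?S \<in> carrier_mat n n" and Ms: "M s \<in> carrier_mat n n" using insert.prems by auto
  have KH: "mat_adjoint K \<in> carrier_mat n m" using K by simp
  have KM: "K * M s * mat_adjoint K \<in> carrier_mat m m"
    using mult_carrier_mat[OF mult_carrier_mat[OF K Ms] KH] .
  have IH: "K * ?S * mat_adjoint K = mat m m (\<lambda>p. \<Sum>r\<in>I. (K * M r * mat_adjoint K) $$ p)"
    by (rule insert.IH) (use insert.prems in auto)
  have "mat n n (\<lambda>p. \<Sum>r\<in>insert s I. M r $$ p) = M s + ?S"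
    by (rule eq_matI) (use insert in auto)
  also have "K * \<dots> * mat_adjoint K = K * M s * mat_adjoint K + K * ?S * mat_adjoint K"
    unfolding mult_add_distrib_mat[OF K Ms S]
    by (rule add_mult_distrib_mat[OF mult_carrier_mat[OF K Ms] mult_carrier_mat[OF K S] KH])
  also have "\<dots> = mat m m (\<lambda>p. \<Sum>r\<in>insert s I. (K * M r * mat_adjoint K) $$ p)"
    unfolding IH by (rule eq_matI) (use KM insert.hyps in auto)
  finally show ?case .
qed

section \<open>The game with direct channels of full row rank\<close>

locale mimo_game =
  fixes Q :: nat
    and nR nT :: "nat \<Rightarrow> nat"
    and H :: "nat \<Rightarrow> nat \<Rightarrow> complex mat"
    and Rn :: "nat \<Rightarrow> complex mat"
    and P :: "nat \<Rightarrow> real"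
  assumes Q: "1 \<le> Q"
    and nR: "\<And>q. q \<in> {1..Q} \<Longrightarrow> 1 \<le> nR q"
    and nT: "\<And>q. q \<in> {1..Q} \<Longrightarrow> 1 \<le> nT q"
    and H: "\<And>r q. r \<in> {1..Q} \<Longrightarrow> q \<in> {1..Q} \<Longrightarrow> H r q \<in> carrier_mat (nR q) (nT r)"
    and Rn: "\<And>q. q \<in> {1..Q} \<Longrightarrow> Rn q \<in> carrier_mat (nR q) (nR q)"
    and Rn_posdef: "\<And>q. q \<in> {1..Q} \<Longrightarrow> posdef_mat (Rn q)"
    and P: "\<And>q. q \<in> {1..Q} \<Longrightarrow> 0 < P q"
    and full_rank: "\<And>q. q \<in> {1..Q} \<Longrightarrow> mat_rank (H q q) = nR q"
begin

lemma profile: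
  assumes "X \<in> strategy_profiles Q nT P" "r \<in> {1..Q}"
  shows "X r \<in> carrier_mat (nT r) (nT r)" "psd_mat (X r)"
  using assms unfolding strategy_profiles_def strategy_set_def by (auto simp: PiE_iff)

lemma interference_cov_carrier:
  "q \<in> {1..Q} \<Longrightarrow> interference_cov Q H Rn q X \<in> carrier_mat (nR q) (nR q)"
  unfolding interference_cov_def using Rn[of q] by auto

lemma interference_cov_posdef:
  assumes q: "q \<in> {1..Q}" and X: "X \<in> strategy_profiles Q nT P"
  shows "mat_adjoint (interference_cov Q H Rn q X) = interference_cov Q H Rn q X"
    and "\<And>v. v \<in> carrier_vec (nR q) \<Longrightarrow> v \<noteq> 0\<^sub>v (nR q)
      \<Longrightarrow> 0 < Re ((interference_cov Q H Rn q X *\<^sub>v v) \<bullet>c v)"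
proof -
  have eq: "interference_cov Q H Rn q X = mat (nR q) (nR q) (\<lambda>p. Rn q $$ p +
      (\<Sum>r\<in>{1..Q} - {q}. (H r q * X r * mat_adjoint (H r q)) $$ p))"
    unfolding interference_cov_def using Rn[OF q] by simp
  have cong: "H r q \<in> carrier_mat (nR q) (nT r)" "X r \<in> carrier_mat (nT r) (nT r)" "psd_mat (X r)"
    if "r \<in> {1..Q} - {q}" for r
    using H[of r q] that q profile[OF X, of r] by auto
  have "H r q * X r * mat_adjoint (H r q) \<in> carrier_mat (nR q) (nR q)"
    if "r \<in> {1..Q} - {q}" for r
    using mult_carrier_mat[OF mult_carrier_mat mat_adjoint_carrier] cong[OF that] by blast
  note posdef = posdef_plus_entrywise_sum[where I = "{1..Q} - {q}"
      and M = "\<lambda>r. H r q * X r * mat_adjoint (H r q)", OF Rn[OF q] Rn_posdef[OF q] this,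
      folded eq]
  show "mat_adjoint (interference_cov Q H Rn q X) = interference_cov Q H Rn q X"
    by (rule posdef(1)) (use psd_congruence[OF cong] in auto)
  show "0 < Re ((interference_cov Q H Rn q X *\<^sub>v v) \<bullet>c v)"
    if "v \<in> carrier_vec (nR q)" "v \<noteq> 0\<^sub>v (nR q)" for v
    by (rule posdef(2)) (use psd_congruence[OF cong] that in auto)
qed

text \<open>\<open>A\<close> varies with the profile through an inverse and is therefore kept
  existential. Exported are the facts that the nonexpansive estimate asks of each of two profiles,
  with a projector \<open>K * H q q\<close> that is the same for both.\<close>

lemma waterfilling_user_is_waterfilling:
  assumes q: "q \<in> {1..Q}" and X: "X \<in> strategy_profiles Q nT P"
  defines "K \<equiv> pseudoinverse (H q q)"
  obtains A where "A \<in> carrier_mat (nT q) (nT q)"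
    "is_waterfilling A (nR q) (P q) (waterfilling_user Q H Rn P q X)"
    "is_pseudoinverse A (K * interference_cov Q H Rn q X * mat_adjoint K)"
    "A * (K * interference_cov Q H Rn q X * mat_adjoint K) = K * H q q"
proof -
  let ?R = "interference_cov Q H Rn q X"
  note Hq = H[OF q q] and R = interference_cov_carrier[OF q, of X]
  note pos = interference_cov_posdef[OF q X]
  have "v = 0\<^sub>v (nR q)" if "v \<in> carrier_vec (nR q)" "?R *\<^sub>v v = 0\<^sub>v (nR q)" for v
    using pos(2)[OF that(1)] that by force
  then obtain J where Ji: "mat_inverse ?R = Some J" and J: "J \<in> carrier_mat (nR q) (nR q)"
    and RJ: "?R * J = 1\<^sub>m (nR q)" "J * ?R = 1\<^sub>m (nR q)"
    using injective_mat_inverse[OF R] by metis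
  obtain Y where Y: "Y \<in> carrier_mat (nT q) (nR q)" and pY: "is_pseudoinverse (H q q) Y"
    and HY: "H q q * Y = 1\<^sub>m (nR q)"
    using full_row_rank_right_pseudoinverse[OF Hq full_rank[OF q]] by metis
  have KY: "K = Y" unfolding K_def by (rule pseudoinverse_eqI[OF pY])
  let ?A = "mat_adjoint (H q q) * J * H q q"
  have HH: "mat_adjoint (H q q) \<in> carrier_mat (nT q) (nR q)" using Hq by simp
  have A: "?A \<in> carrier_mat (nT q) (nT q)" using mult_carrier_mat[OF mult_carrier_mat[OF HH J] Hq] .
  obtain U d where "reduced_eigendecomp ?A (nR q) U d"
    using sandwich_reduced_eigendecomp[OF Hq full_row_rank_adjoint_inj[OF Hq full_rank[OF q]] R pos J RJ]
    by blast
  \<comment> \<open>One receive antenna at least means one channel at least, so some water level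
    meets the positive power budget.\<close>
  then obtain W where W: "is_waterfilling ?A (nR q) (P q) W"
    using is_waterfilling_exists[of ?A "nR q" U d "P q"] nR[OF q] P[OF q] by auto
  have "waterfilling_user Q H Rn P q X = W"
    unfolding waterfilling_user_def Ji option.sel full_rank[OF q]
    using W is_waterfilling_unique by blast
  then show ?thesis
    using that[OF A] W sandwich_pseudoinverse[OF Hq Y pY HY R J RJ] KY by simp
qed

lemma waterfilling_in_profiles:
  assumes X: "X \<in> strategy_profiles Q nT P"
  shows "waterfilling Q H Rn P X \<in> strategy_profiles Q nT P"
proof -
  have "waterfilling_user Q H Rn P q X \<in> strategy_set nT P q" if q: "q \<in> {1..Q}" for q
  proof -
    obtain A where "A \<in> carrier_mat (nT q) (nT q)"
      "is_waterfilling A (nR q) (P q) (waterfilling_user Q H Rn P q X)"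
      using waterfilling_user_is_waterfilling[OF q X] by blast
    from is_waterfilling_carrier[OF this] show ?thesis unfolding strategy_set_def by simp
  qed
  then show ?thesis unfolding strategy_profiles_def waterfilling_def by auto
qed

lemma S_mat_nonneg:
  assumes q: "q \<in> {1..Q}" and r: "r \<in> {1..Q}"
  shows "0 \<le> S_mat H q r"
proof (cases "r = q")
  case False
  have "dim_row (H r q) = nR q" "dim_col (H r q) = nT r" using H[OF r q] by auto
  then have "mat_adjoint (H r q) * mat_adjoint (pseudoinverse (H q q))
                        * pseudoinverse (H q q) * H r q \<in> carrier_mat (nT r) (nT r)"
    by auto
  then show ?thesis
    unfolding S_mat_def using spectral_radius_nonneg nT[OF r] by auto
qed (simp add: S_mat_def)

lemma waterfilling_user_lipschitz:
  assumes q: "q \<in> {1..Q}"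
    and X: "X \<in> strategy_profiles Q nT P" and Y: "Y \<in> strategy_profiles Q nT P"
  shows "frobenius_norm (waterfilling_user Q H Rn P q X - waterfilling_user Q H Rn P q Y)
    \<le> (\<Sum>r\<in>{1..Q} - {q}. S_mat H q r * frobenius_norm (X r - Y r))"
proof -
  let ?I = "{1..Q} - {q}"
  define K where "K = pseudoinverse (H q q)"
  have K: "K \<in> carrier_mat (nT q) (nR q)"
  proof -
    obtain Z where "Z \<in> carrier_mat (nT q) (nR q)" "is_pseudoinverse (H q q) Z"
      using full_row_rank_right_pseudoinverse[OF H[OF q q] full_rank[OF q]] by metis
    then show ?thesis unfolding K_def using pseudoinverse_eqI by metis
  qed
  have KH: "mat_adjoint K \<in> carrier_mat (nR q) (nT q)" using K by simp
  let ?R = "\<lambda>X. interference_cov Q H Rn q X"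
  note R = interference_cov_carrier[OF q]
  define M where "M r = H r q * (X r - Y r) * mat_adjoint (H r q)" for r
  have car: "H r q \<in> carrier_mat (nR q) (nT r)" "X r \<in> carrier_mat (nT r) (nT r)"
      "Y r \<in> carrier_mat (nT r) (nT r)" "mat_adjoint (H r q) \<in> carrier_mat (nT r) (nR q)"
    if "r \<in> ?I" for r
    using H[of r q] q that profile(1)[OF X, of r] profile(1)[OF Y, of r] by auto
  have D: "X r - Y r \<in> carrier_mat (nT r) (nT r)" if "r \<in> ?I" for r using car[OF that] by auto
  have M: "M r \<in> carrier_mat (nR q) (nR q)" if "r \<in> ?I" for r
    unfolding M_def using mult_carrier_mat[OF mult_carrier_mat[OF car(1)[OF that] D[OF that]] car(4)[OF that]] .
  obtain A where A: "is_waterfilling A (nR q) (P q) (waterfilling_user Q H Rn P q X)"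
    "is_pseudoinverse A (K * ?R X * mat_adjoint K)" "A * (K * ?R X * mat_adjoint K) = K * H q q"
    using waterfilling_user_is_waterfilling[OF q X] unfolding K_def by metis
  obtain B where B: "is_waterfilling B (nR q) (P q) (waterfilling_user Q H Rn P q Y)"
    "is_pseudoinverse B (K * ?R Y * mat_adjoint K)" "B * (K * ?R Y * mat_adjoint K) = K * H q q"
    using waterfilling_user_is_waterfilling[OF q Y] unfolding K_def by metis
  \<comment> \<open>The noise covariance cancels in the difference, which leaves the interference of
    the other users alone.\<close>
  have "?R X - ?R Y = mat (nR q) (nR q) (\<lambda>p. \<Sum>r\<in>?I. M r $$ p)"
  proof (rule eq_matI)
    fix i j assume "i < dim_row (mat (nR q) (nR q) (\<lambda>p. \<Sum>r\<in>?I. M r $$ p))"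
      "j < dim_col (mat (nR q) (nR q) (\<lambda>p. \<Sum>r\<in>?I. M r $$ p))"
    then have ij: "i < nR q" "j < nR q" by auto
    have "M r $$ (i, j) = (H r q * X r * mat_adjoint (H r q)) $$ (i, j)
        - (H r q * Y r * mat_adjoint (H r q)) $$ (i, j)" if r: "r \<in> ?I" for r
    proof -
      note c = car[OF r]
      have HX: "H r q * X r \<in> carrier_mat (nR q) (nT r)" and HY: "H r q * Y r \<in> carrier_mat (nR q) (nT r)"
        using mult_carrier_mat[OF c(1)] c by auto
      have "M r = H r q * X r * mat_adjoint (H r q) - H r q * Y r * mat_adjoint (H r q)"
        unfolding M_def mult_minus_distrib_mat[OF c(1-3)] minus_mult_distrib_mat[OF HX HY c(4)] ..
      then show ?thesis using ij carrier_matD[OF c(1)] by simp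
    qed
    then show "(?R X - ?R Y) $$ (i, j) = mat (nR q) (nR q) (\<lambda>p. \<Sum>r\<in>?I. M r $$ p) $$ (i, j)"
      using ij Rn[OF q] unfolding interference_cov_def by (simp add: sum_subtractf)
  qed (use R in auto)
  then have "K * ?R X * mat_adjoint K - K * ?R Y * mat_adjoint K
      = mat (nT q) (nT q) (\<lambda>p. \<Sum>r\<in>?I. (K * M r * mat_adjoint K) $$ p)"
    using congruence_entrywise_sum[where I = ?I and M = M, OF K _ M]
      mult_minus_distrib_mat[OF K R[of X] R[of Y]]
      minus_mult_distrib_mat[OF mult_carrier_mat[OF K R[of X]] mult_carrier_mat[OF K R[of Y]] KH]
    by simp
  then have "frobenius_norm (waterfilling_user Q H Rn P q X - waterfilling_user Q H Rn P q Y)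
      \<le> frobenius_norm (mat (nT q) (nT q) (\<lambda>p. \<Sum>r\<in>?I. (K * M r * mat_adjoint K) $$ p))"
    using is_waterfilling_lipschitz[OF A(1) B(1) A(2) B(2)] A(3) B(3) by simp
  also have "\<dots> \<le> (\<Sum>r\<in>?I. frobenius_norm (K * M r * mat_adjoint K))"
    by (rule frobenius_norm_entrywise_sum)
      (use mult_carrier_mat[OF mult_carrier_mat[OF K M] KH] in auto)
  also have "\<dots> \<le> (\<Sum>r\<in>?I. S_mat H q r * frobenius_norm (X r - Y r))"
  proof (rule sum_mono)
    fix r assume r: "r \<in> ?I"
    note c = car[OF r]
    \<comment> \<open>Absorbing the cross channel into \<open>?L\<close> makes the term a congruence
      of \<open>X r - Y r\<close>, and L^H L is the very matrix whose spectral radius is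
      \<open>S_mat H q r\<close>.\<close>
    let ?L = "K * H r q"
    have L: "?L \<in> carrier_mat (nT q) (nT r)" using mult_carrier_mat[OF K c(1)] .
    note dims = carrier_matD[OF K] carrier_matD[OF c(1)] carrier_matD[OF D[OF r]]
    have LH: "mat_adjoint ?L = mat_adjoint (H r q) * mat_adjoint K" by (rule mat_adjoint_mult[OF K c(1)])
    have "K * M r * mat_adjoint K = ?L * (X r - Y r) * mat_adjoint ?L"
      unfolding LH M_def by (simp add: mult_assoc_dim dims del: index_minus_mat)
    moreover have "S_mat H q r = spectral_radius (mat_adjoint ?L * ?L)"
      unfolding LH S_mat_def K_def[symmetric] using r by (simp add: mult_assoc_dim dims)
    ultimately show "frobenius_norm (K * M r * mat_adjoint K) \<le> S_mat H q r * frobenius_norm (X r - Y r)"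
      using frobenius_norm_congruence[OF L _ D[OF r]] nT[of r] r by simp
  qed
  finally show ?thesis .
qed

lemma block_norm_waterfilling_le:
  assumes w: "\<And>q. q \<in> {1..Q} \<Longrightarrow> 0 < w q"
    and X: "X \<in> strategy_profiles Q nT P" and Y: "Y \<in> strategy_profiles Q nT P"
  shows "block_norm Q w (\<lambda>q. waterfilling Q H Rn P X q - waterfilling Q H Rn P Y q)
    \<le> weighted_max_norm Q w (S_mat H) * block_norm Q w (\<lambda>q. X q - Y q)"
proof -
  let ?N = "block_norm Q w (\<lambda>q. X q - Y q)"
  have N: "frobenius_norm (X r - Y r) / w r \<le> ?N" if "r \<in> {1..Q}" for r
    unfolding block_norm_def by (rule Max_ge) (use that in auto)
  \<comment> \<open>User 1 exists since \<open>1 \<le> Q\<close>; the sign of the maximum is read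
    off from this entry.\<close>
  have "0 \<le> frobenius_norm (X 1 - Y 1) / w 1" using w[of 1] Q by (simp add: less_imp_le)
  then have N0: "0 \<le> ?N" using N[of 1] Q by simp
  have "frobenius_norm (waterfilling Q H Rn P X q - waterfilling Q H Rn P Y q) / w q
      \<le> weighted_max_norm Q w (S_mat H) * ?N" if q: "q \<in> {1..Q}" for q
  proof -
    have "frobenius_norm (waterfilling Q H Rn P X q - waterfilling Q H Rn P Y q)
        \<le> (\<Sum>r\<in>{1..Q} - {q}. S_mat H q r * frobenius_norm (X r - Y r))"
      using waterfilling_user_lipschitz[OF q X Y] q unfolding waterfilling_def by simp
    also have "\<dots> = (\<Sum>r\<in>{1..Q} - {q}. \<bar>S_mat H q r\<bar> * frobenius_norm (X r - Y r))"
      using S_mat_nonneg[OF q] by (intro sum.cong refl) simp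
    \<comment> \<open>Adding the term \<open>r = q\<close> costs nothing, as the diagonal of
      \<open>S_mat H\<close> is zero, and gives the full row sum of
      \<open>weighted_max_norm\<close>.\<close>
    also have "\<dots> \<le> (\<Sum>r=1..Q. \<bar>S_mat H q r\<bar> * frobenius_norm (X r - Y r))"
      by (rule sum_mono2) auto
    also have "\<dots> \<le> (\<Sum>r=1..Q. \<bar>S_mat H q r\<bar> * (w r * ?N))"
    proof (intro sum_mono mult_left_mono)
      fix r assume r: "r \<in> {1..Q}"
      show "frobenius_norm (X r - Y r) \<le> w r * ?N"
        using N[OF r] w[OF r] by (simp add: pos_divide_le_eq mult.commute)
    qed simp
    also have "\<dots> = (\<Sum>r=1..Q. \<bar>S_mat H q r\<bar> * w r) * ?N"
      by (simp add: sum_distrib_right mult.assoc)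
    finally have "frobenius_norm (waterfilling Q H Rn P X q - waterfilling Q H Rn P Y q) / w q
        \<le> 1 / w q * (\<Sum>r=1..Q. \<bar>S_mat H q r\<bar> * w r) * ?N"
      using w[OF q] by (simp add: field_simps)
    also have "\<dots> \<le> weighted_max_norm Q w (S_mat H) * ?N"
      unfolding weighted_max_norm_def by (rule mult_right_mono[OF Max_ge N0]) (use q in auto)
    finally show ?thesis .
  qed
  then show ?thesis unfolding block_norm_def[of Q w "\<lambda>q. waterfilling Q H Rn P X q - waterfilling Q H Rn P Y q"]
    by (subst Max_le_iff) (use Q in auto)
qed

text \<open>Row 1 is nonnegative and bounds the maximum from below; this settles the sign condition
  on the contraction modulus.\<close>

lemma weighted_max_norm_S_mat_nonneg:
  assumes w: "\<And>q. q \<in> {1..Q} \<Longrightarrow> 0 < w q"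
  shows "0 \<le> weighted_max_norm Q w (S_mat H)"
proof -
  have "0 \<le> 1 / w 1 * (\<Sum>r=1..Q. \<bar>S_mat H 1 r\<bar> * w r)"
    using w Q by (intro mult_nonneg_nonneg sum_nonneg) (auto simp: less_imp_le)
  also have "\<dots> \<le> weighted_max_norm Q w (S_mat H)"
    unfolding weighted_max_norm_def by (rule Max_ge) (use Q in auto)
  finally show ?thesis .
qed

end

theorem theorem5:
  fixes Q :: nat
    and nR nT :: "nat \<Rightarrow> nat"
    and H :: "nat \<Rightarrow> nat \<Rightarrow> complex mat"
    and Rn :: "nat \<Rightarrow> complex mat"
    and P :: "nat \<Rightarrow> real"
  assumes "1 \<le> Q"
    and "\<And>q. q \<in> {1..Q} \<Longrightarrow> 1 \<le> nR q"
    and "\<And>q. q \<in> {1..Q} \<Longrightarrow> 1 \<le> nT q"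
    and "\<And>r q. r \<in> {1..Q} \<Longrightarrow> q \<in> {1..Q} \<Longrightarrow> H r q \<in> carrier_mat (nR q) (nT r)"
    and "\<And>q. q \<in> {1..Q} \<Longrightarrow> Rn q \<in> carrier_mat (nR q) (nR q)"
    and "\<And>q. q \<in> {1..Q} \<Longrightarrow> posdef_mat (Rn q)"
    and "\<And>q. q \<in> {1..Q} \<Longrightarrow> 0 < P q"
    and "\<And>q. q \<in> {1..Q} \<Longrightarrow> mat_rank (H q q) = nR q"
  shows "waterfilling Q H Rn P \<in> strategy_profiles Q nT P \<rightarrow> strategy_profiles Q nT P \<and>
    (\<forall>w :: nat \<Rightarrow> real. (\<forall>q\<in>{1..Q}. 0 < w q) \<longrightarrow>
       (\<forall>X1\<in>strategy_profiles Q nT P. \<forall>X2\<in>strategy_profiles Q nT P.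
          block_norm Q w (\<lambda>q. waterfilling Q H Rn P X1 q - waterfilling Q H Rn P X2 q)
            \<le> weighted_max_norm Q w (S_mat H) * block_norm Q w (\<lambda>q. X1 q - X2 q))) \<and>
    (\<forall>w :: nat \<Rightarrow> real. (\<forall>q\<in>{1..Q}. 0 < w q) \<longrightarrow>
       weighted_max_norm Q w (S_mat H) < 1 \<longrightarrow>
       contraction_with_modulus (block_dist Q w) (strategy_profiles Q nT P)
         (waterfilling Q H Rn P) (weighted_max_norm Q w (S_mat H)))"
proof -
  interpret mimo_game Q nR nT H Rn P by unfold_locales (use assms in auto)
  show ?thesis
    using waterfilling_in_profiles block_norm_waterfilling_le weighted_max_norm_S_mat_nonneg
    unfolding contraction_with_modulus_def block_dist_def by (intro conjI allI impI ballI) auto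
qed

end
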